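(* Let $m$ be an even number and let $\mathcal{A}$ be a real symmetric extended $Z$-tensor of order $m$ and dimension $n$. Then the associated multivariate form $\mathcal{A}\mathbf{x}^m$ is positive definite if and only if $$\max_{\mu,r\in\mathbb{R}}\{\mu: f_{\mathcal{A}}(\mathbf{x})-r(\|\mathbf{x}\|_m^m-1)-\mu\in\Sigma_m^2[\mathbf{x}]\}>0,$$ where $f_{\mathcal{A}}(\mathbf{x})=\mathcal{A}\mathbf{x}^m$ and $\Sigma_m^2[\mathbf{x}]$ is the set of all SOS polynomials with degree at most $m$.
   Context: A real tensor of order $m$ and dimension $n$ is an array $\mathcal{A}=(a_{i_1\cdots i_m})$ with $i_1,\dots,i_m\in[n]=\{1,\dots,n\}$; it is symmetric if its entries are invariant under permutations of the indices. $\mathcal{A}\mathbf{x}^m=\sum_{i_1,\dots,i_m\in[n]}a_{i_1\cdots i_m}x_{i_1}\cdots x_{i_m}$ for $\mathbf{x}\in\mathbb{R}^n$; this form is positive definite if $\mathcal{A}\mathbf{x}^m>0$ for all $\mathbf{x}\ne\mathbf{0}$. SOS polynomials are finite sums of squares of real polynomials. $\|\mathbf{x}\|_m=(\sum_{i=1}^n|x_i|^m)^{1/m}$. A polynomial $f$ of degree $m$ on $\mathbb{R}^n$ is an extended $Z$-polynomial if there exist $s\in\mathbb{N}$, $s\le n$, and index sets $\Gamma_1,\dots,\Gamma_s\subseteq[n]$ with $\bigcup_{l=1}^s\Gamma_l=[n]$ and $\Gamma_{l_1}\cap\Gamma_{l_2}=\emptyset$ for $l_1\ne l_2$, such that $f(\mathbf{x})=\sum_{i=1}^n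 f_{m,i}x_i^m+\sum_{l=1}^s\sum_{\alpha_l\in\Omega_l}f_{\alpha_l}\mathbf{x}^{\alpha_l}$, where $f_{m,i}$ is the coefficient of $x_i^m$ in $f$, $\Omega_l$ is the set of $\alpha\in(\mathbb{N}\cup\{0\})^n$ with $|\alpha|=m$, $\mathbf{x}^\alpha=x_{i_1}\cdots x_{i_m}$ with $\{i_1,\dots,i_m\}\subseteq\Gamma_l$, and $\alpha\ne m\,\mathbf{e}_i$ for all $i$ ($\mathbf{e}_i$ the $i$th unit vector), and for each $l=1,\dots,s$ one of the following holds: (1) $f_{\alpha_l}=0$ for all but one $\alpha_l\in\Omega_l$; (2) $f_{\alpha_l}\le0$ for all $\alpha_l\in\Omega_l$. A symmetric tensor $\mathcal{A}$ is an extended $Z$-tensor if $f_{\mathcal{A}}$ is an extended $Z$-polynomial. *)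

theory Defs
  imports
    "HOL-Analysis.Analysis"
    "HOL-Library.Poly_Mapping"
    "HOL-Combinatorics.Permutations"
begin

(* Real polynomials in the variables indexed by the finite type 'n, i.e. R[x_1, ..., x_n] with
   n = CARD('n): an exponent vector is a map from 'n to nat, and a polynomial is a finitely
   supported map from exponent vectors to the reals, with convolution as product. *)
type_synonym 'n mpoly = "('n \<Rightarrow>\<^sub>0 nat) \<Rightarrow>\<^sub>0 real"

definition mon_degree :: "('n::finite \<Rightarrow>\<^sub>0 nat) \<Rightarrow> nat" where
  "mon_degree \<alpha> = (\<Sum>i\<in>UNIV. Poly_Mapping.lookup \<alpha> i)"

(* The zero polynomial gets degree 0. *)
definition total_degree :: "'n::finite mpoly \<Rightarrow> nat" where
  "total_degree f = Max (insert 0 (mon_degree ` Poly_Mapping.keys f))"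

definition poly_fun :: "'n::finite mpoly \<Rightarrow> real ^ 'n \<Rightarrow> real" where
  "poly_fun f x =
     (\<Sum>\<alpha>\<in>Poly_Mapping.keys f. Poly_Mapping.lookup f \<alpha> * (\<Prod>i\<in>UNIV. (x $ i) ^ Poly_Mapping.lookup \<alpha> i))"

definition sos_polys :: "nat \<Rightarrow> 'n::finite mpoly set" where
  "sos_polys m = {f. total_degree f \<le> m \<and> (\<exists>qs. f = (\<Sum>q\<leftarrow>qs. q\<^sup>2))}"

(* A tensor of order m and dimension CARD('n) is given by its entries at the index lists of
   length m; the values at lists of any other length are irrelevant. *)
type_synonym 'n tensor = "'n list \<Rightarrow> real"

definition symmetric_tensor :: "nat \<Rightarrow> 'n tensor \<Rightarrow> bool" where
  "symmetric_tensor m A \<longleftrightarrow>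
     (\<forall>is \<sigma>. length is = m \<and> \<sigma> permutes {..<m} \<longrightarrow> A (permute_list \<sigma> is) = A is)"

definition tensor_form :: "nat \<Rightarrow> 'n::finite tensor \<Rightarrow> real ^ 'n \<Rightarrow> real" where
  "tensor_form m A x = (\<Sum>is | length is = m. A is * (\<Prod>i\<leftarrow>is. x $ i))"

definition tensor_poly :: "nat \<Rightarrow> 'n::finite tensor \<Rightarrow> 'n mpoly" where
  "tensor_poly m A =
     (\<Sum>is | length is = m. Poly_Mapping.single (\<Sum>i\<leftarrow>is. Poly_Mapping.single i 1) (A is))"

definition positive_definite_form :: "nat \<Rightarrow> 'n::finite tensor \<Rightarrow> bool" where
  "positive_definite_form m A \<longleftrightarrow> (\<forall>x. x \<noteq> 0 \<longrightarrow> tensor_form m A x > 0)"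

definition m_norm :: "nat \<Rightarrow> real ^ 'n::finite \<Rightarrow> real" where
  "m_norm m x = (\<Sum>i\<in>UNIV. \<bar>x $ i\<bar> ^ m) powr (1 / real m)"

(* The feasible values of mu. Membership in the SOS polynomials is stated through polynomial
   functions, which determine their polynomials since the reals are infinite; so the m-th power
   of the m-norm appears as it stands, not as the sum of the x_i^m (they agree for even m). *)
definition sos_values :: "nat \<Rightarrow> 'n::finite tensor \<Rightarrow> real set" where
  "sos_values m A =
     {\<mu>. \<exists>r. (\<lambda>x. tensor_form m A x - r * (m_norm m x ^ m - 1) - \<mu>) \<in> poly_fun ` sos_polys m}"

definition Omega :: "nat \<Rightarrow> 'n::finite set \<Rightarrow> ('n \<Rightarrow>\<^sub>0 nat) set" where
  "Omega m G =
     {\<alpha>. mon_degree \<alpha> = m \<and> Poly_Mapping.keys \<alpha> \<subseteq> G \<and> (\<forall>i. \<alpha> \<noteq> Poly_Mapping.single i m)}"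

(* The zero form is admitted as a form of degree m, so that the zero tensor is an extended
   Z-tensor; otherwise the degree is exactly m. *)
definition extended_Z_polynomial :: "nat \<Rightarrow> 'n::finite mpoly \<Rightarrow> bool" where
  "extended_Z_polynomial m f \<longleftrightarrow>
     (f = 0 \<or> total_degree f = m) \<and>
     (\<exists>s \<Gamma>. 1 \<le> s \<and> s \<le> CARD('n) \<and>
        (\<Union>l\<in>{1..s}. \<Gamma> l) = (UNIV :: 'n set) \<and>
        (\<forall>l\<in>{1..s}. \<forall>l'\<in>{1..s}. l \<noteq> l' \<longrightarrow> \<Gamma> l \<inter> \<Gamma> l' = {}) \<and>
        f = (\<Sum>i\<in>UNIV. Poly_Mapping.single (Poly_Mapping.single i m)
                           (Poly_Mapping.lookup f (Poly_Mapping.single i m)))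
            + (\<Sum>l = 1..s. \<Sum>\<alpha>\<in>Omega m (\<Gamma> l). Poly_Mapping.single \<alpha> (Poly_Mapping.lookup f \<alpha>)) \<and>
        (\<forall>l\<in>{1..s}.
           (\<exists>\<beta>\<in>Omega m (\<Gamma> l). \<forall>\<alpha>\<in>Omega m (\<Gamma> l) - {\<beta>}. Poly_Mapping.lookup f \<alpha> = 0) \<or>
           (\<forall>\<alpha>\<in>Omega m (\<Gamma> l). Poly_Mapping.lookup f \<alpha> \<le> 0)))"

definition extended_Z_tensor :: "nat \<Rightarrow> 'n::finite tensor \<Rightarrow> bool" where
  "extended_Z_tensor m A \<longleftrightarrow> symmetric_tensor m A \<and> extended_Z_polynomial m (tensor_poly m A)"

lemma finite_Omega: "finite (Omega m (G :: 'n::finite set))"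
proof -
  have "Poly_Mapping.lookup ` Omega m G \<subseteq> {f. \<forall>i. f i \<in> {..m}}"
  proof clarsimp
    fix \<alpha> :: "'n \<Rightarrow>\<^sub>0 nat" and i
    assume "\<alpha> \<in> Omega m G"
    then have "(\<Sum>i\<in>UNIV. Poly_Mapping.lookup \<alpha> i) = m" by (simp add: Omega_def mon_degree_def)
    then show "Poly_Mapping.lookup \<alpha> i \<le> m"
      using member_le_sum[of i UNIV "Poly_Mapping.lookup \<alpha>"] by simp
  qed
  moreover have "finite {f :: 'n \<Rightarrow> nat. \<forall>i. f i \<in> {..m}}"
    using finite_PiE[of "UNIV :: 'n set" "\<lambda>_. {..m}"] by (simp add: PiE_UNIV_domain Pi_def)
  ultimately have "finite (Poly_Mapping.lookup ` Omega m G)"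
    by (rule finite_subset)
  then show ?thesis
    by (rule finite_imageD) (simp add: inj_on_def poly_mapping_eqI)
qed

lemma poly_fun_eq:
  assumes "finite S" "Poly_Mapping.keys f \<subseteq> S"
  shows "poly_fun f x =
    (\<Sum>\<alpha>\<in>S. Poly_Mapping.lookup f \<alpha> * (\<Prod>i\<in>UNIV. (x $ i) ^ Poly_Mapping.lookup \<alpha> i))"
  unfolding poly_fun_def using assms
  by (intro sum.mono_neutral_left) (auto simp: in_keys_iff)

lemma poly_fun_zero [simp]: "poly_fun 0 x = 0"
  by (simp add: poly_fun_def)

lemma poly_fun_add: "poly_fun (f + g) x = poly_fun f x + poly_fun g x"
proof -
  let ?S = "Poly_Mapping.keys f \<union> Poly_Mapping.keys g"
  have "Poly_Mapping.keys (f + g) \<subseteq> ?S" by (rule Poly_Mapping.keys_add)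
  then show ?thesis
    by (simp add: poly_fun_eq[of ?S] lookup_add distrib_right sum.distrib)
qed

lemma poly_fun_sum: "poly_fun (\<Sum>a\<in>S. f a) x = (\<Sum>a\<in>S. poly_fun (f a) x)"
  by (induction S rule: infinite_finite_induct) (simp_all add: poly_fun_add)

lemma poly_fun_single:
  "poly_fun (Poly_Mapping.single \<alpha> c) x = c * (\<Prod>i\<in>UNIV. (x $ i) ^ Poly_Mapping.lookup \<alpha> i)"
  by (subst poly_fun_eq[of "{\<alpha>}"]) auto

lemma prod_lookup_index_list:
  "(\<Prod>j\<in>UNIV. (x $ j) ^ Poly_Mapping.lookup (\<Sum>i\<leftarrow>is. Poly_Mapping.single i 1) j) = (\<Prod>i\<leftarrow>is. x $ i)"
  for x :: "real ^ 'n::finite"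
proof (induction "is")
  case (Cons a "is")
  have "(\<Prod>j\<in>UNIV. (x $ j) ^ Poly_Mapping.lookup (Poly_Mapping.single a (1::nat)) j) =
        (\<Prod>j\<in>UNIV. if j = a then x $ a else 1)"
    by (intro prod.cong) (auto simp: lookup_single when_def)
  also have "\<dots> = x $ a" by simp
  finally show ?case
    using Cons by (simp add: lookup_add power_add prod.distrib)
qed simp

lemma poly_fun_tensor_poly: "poly_fun (tensor_poly m A) x = tensor_form m A x"
  unfolding tensor_poly_def tensor_form_def poly_fun_sum poly_fun_single prod_lookup_index_list ..

lemma m_norm_power: "m > 0 \<Longrightarrow> m_norm m x ^ m = (\<Sum>i\<in>UNIV. \<bar>x $ i\<bar> ^ m)"
  unfolding m_norm_def
  by (subst powr_realpow'[symmetric]) (auto simp: powr_powr sum_nonneg)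

end

theory Submission
  imports Defs
begin

text \<open>Let \<open>\<rho>\<close> be the minimum of the form on the unit sphere of the \<open>m\<close>-norm. Evaluating at a
  minimiser bounds every feasible value by \<open>\<rho>\<close>, so everything rests on \<open>\<rho>\<close> itself being feasible:
  a nonnegative extended Z-form (the given one minus \<open>\<rho> * (\<Sum>i. x i ^ m)\<close>) is a sum of squares.

  By restricting to a block and flipping a sign, one may replace every off-diagonal coefficient
  \<open>f\<close> (except positive ones of squares) by \<open>- \<bar>f\<bar>\<close> and keep nonnegativity on the orthant. A critical
  point then splits the diagonal part among the off-diagonal monomials such that each piece is an instance
  of the weighted AM-GM inequality, and these are sums of squares by Hurwitz. To make the critical point
  strictly positive the form is perturbed; the AM-GM condition on the weights is closed, so it
  survives the passage to the limit.\<close>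

section \<open>Monomial functions, evaluation and degree of polynomials\<close>

abbreviation sos_functions :: "nat \<Rightarrow> (real ^ 'n::finite \<Rightarrow> real) set" where
  "sos_functions m \<equiv> poly_fun ` sos_polys m"

text \<open>Exponents are plain functions here rather than finitely supported maps, so that they can
  be updated, halved and added pointwise; \<open>Poly_Mapping.lookup\<close> leads from the latter
  to the former.\<close>

definition vpow :: "real ^ 'n::finite \<Rightarrow> ('n \<Rightarrow> nat) \<Rightarrow> real" where
  "vpow x a = (\<Prod>i\<in>UNIV. (x $ i) ^ a i)"

lemma vpow_add: "vpow x (\<lambda>i. a i + b i) = vpow x a * vpow x b"
  by (simp add: vpow_def power_add prod.distrib)

lemma vpow_double: "vpow x (\<lambda>i. 2 * a i) = (vpow x a)\<^sup>2"
  by (simp add: mult_2 vpow_add power2_eq_square)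

lemma vpow_mult: "vpow (x * y) a = vpow x a * vpow y a"
  by (simp add: vpow_def power_mult_distrib prod.distrib)

lemma vpow_nonneg: "(\<And>i. 0 \<le> x $ i) \<Longrightarrow> 0 \<le> vpow x a"
  by (simp add: vpow_def prod_nonneg)

lemma vpow_pos: "(\<And>i. 0 < x $ i) \<Longrightarrow> 0 < vpow x a"
  by (simp add: vpow_def prod_pos)

lemma vpow_upd: "vpow x (a(i := n)) = (x $ i) ^ n * (\<Prod>j\<in>UNIV - {i}. (x $ j) ^ a j)"
  unfolding vpow_def by (subst prod.remove[of _ i]) (auto intro!: prod.cong)

lemma vpow_at:
  "vpow (\<chi> i. if i = j then t else y $ i) a = t ^ a j * (\<Prod>i\<in>UNIV - {j}. (y $ i) ^ a i)"
  unfolding vpow_def by (subst prod.remove[of _ j]) (auto intro!: prod.cong)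

lemma vpow_remove: "vpow x a = (x $ j) ^ a j * (\<Prod>i\<in>UNIV - {j}. (x $ i) ^ a i)"
  unfolding vpow_def by (subst prod.remove[of _ j]) auto

lemma continuous_on_vpow [continuous_intros]:
  "continuous_on S f \<Longrightarrow> continuous_on S (\<lambda>x. vpow (f x) a)"
  unfolding vpow_def by (intro continuous_intros)

lemma poly_fun_single_vpow: "poly_fun (Poly_Mapping.single \<alpha> c) x = c * vpow x (Poly_Mapping.lookup \<alpha>)"
  by (simp add: poly_fun_single vpow_def)

lemma sum_single_keys:
  "f = (\<Sum>\<alpha>\<in>Poly_Mapping.keys f. Poly_Mapping.single \<alpha> (Poly_Mapping.lookup f \<alpha>))"
  for f :: "'k \<Rightarrow>\<^sub>0 'b::comm_monoid_add"
proof (rule poly_mapping_eqI)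
  fix k
  show "Poly_Mapping.lookup f k =
      Poly_Mapping.lookup (\<Sum>\<alpha>\<in>Poly_Mapping.keys f. Poly_Mapping.single \<alpha> (Poly_Mapping.lookup f \<alpha>)) k"
    by (cases "k \<in> Poly_Mapping.keys f")
      (auto simp: lookup_sum lookup_single when_def in_keys_iff)
qed

lemma poly_fun_mult: "poly_fun (f * g) x = poly_fun f x * poly_fun g x"
proof -
  have "f * g = (\<Sum>\<alpha>\<in>Poly_Mapping.keys f. \<Sum>\<beta>\<in>Poly_Mapping.keys g.
      Poly_Mapping.single (\<alpha> + \<beta>) (Poly_Mapping.lookup f \<alpha> * Poly_Mapping.lookup g \<beta>))"
    by (subst sum_single_keys[of f], subst sum_single_keys[of g])
      (simp add: sum_product mult_single)
  then have "poly_fun (f * g) x = (\<Sum>\<alpha>\<in>Poly_Mapping.keys f. \<Sum>\<beta>\<in>Poly_Mapping.keys g.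
      Poly_Mapping.lookup f \<alpha> * Poly_Mapping.lookup g \<beta> * vpow x (Poly_Mapping.lookup (\<alpha> + \<beta>)))"
    by (simp only: poly_fun_sum poly_fun_single_vpow)
  also have "\<dots> = poly_fun f x * poly_fun g x"
    by (simp add: lookup_add[abs_def] vpow_add poly_fun_def[folded vpow_def] sum_product mult_ac)
  finally show ?thesis .
qed

lemma poly_fun_power2: "poly_fun (q\<^sup>2) x = (poly_fun q x)\<^sup>2"
  by (simp add: power2_eq_square poly_fun_mult)

lemma total_degree_le_iff: "total_degree f \<le> m \<longleftrightarrow> (\<forall>\<alpha>\<in>Poly_Mapping.keys f. mon_degree \<alpha> \<le> m)"
  by (simp add: total_degree_def)

lemma mon_degree_add: "mon_degree (\<alpha> + \<beta>) = mon_degree \<alpha> + mon_degree \<beta>"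
  by (simp add: mon_degree_def lookup_add sum.distrib)

lemma total_degree_add_le:
  "total_degree f \<le> m \<Longrightarrow> total_degree g \<le> m \<Longrightarrow> total_degree (f + g) \<le> m"
  using Poly_Mapping.keys_add[of f g] by (auto simp: total_degree_le_iff)

lemma total_degree_mult_le:
  "total_degree f \<le> m \<Longrightarrow> total_degree g \<le> n \<Longrightarrow> total_degree (f * g) \<le> m + n"
  using keys_mult[of f g]
  by (auto simp: total_degree_le_iff mon_degree_add dest!: subsetD intro!: add_mono)

section \<open>The convex cone of SOS functions of bounded degree\<close>

lemma sos_functions_nonneg: "h \<in> sos_functions m \<Longrightarrow> 0 \<le> h x"
proof -
  have "0 \<le> poly_fun (\<Sum>q\<leftarrow>qs. q\<^sup>2) x" for qs :: "'a mpoly list"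
    by (induction qs) (simp_all add: poly_fun_add poly_fun_power2)
  then show "h \<in> sos_functions m \<Longrightarrow> 0 \<le> h x"
    by (auto simp: sos_polys_def)
qed

lemma sos_functions_zero: "(\<lambda>x. 0) \<in> sos_functions m"
proof (rule image_eqI)
  show "0 \<in> sos_polys m"
    by (auto simp: sos_polys_def total_degree_def intro: exI[of _ "[]"])
qed auto

lemma sos_functions_add:
  assumes "f \<in> sos_functions m" "g \<in> sos_functions m"
  shows "(\<lambda>x. f x + g x) \<in> sos_functions m"
proof -
  obtain p q where p: "f = poly_fun p" "p \<in> sos_polys m" and q: "g = poly_fun q" "q \<in> sos_polys m"
    using assms by blast
  obtain ps qs where "p = (\<Sum>q\<leftarrow>ps. q\<^sup>2)" "q = (\<Sum>q\<leftarrow>qs. q\<^sup>2)"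
    using p q by (auto simp: sos_polys_def)
  then have "p + q = (\<Sum>q\<leftarrow>ps @ qs. q\<^sup>2)"
    by simp
  then have "p + q \<in> sos_polys m"
    using p q total_degree_add_le[of p m q] unfolding sos_polys_def by blast
  then show ?thesis
    using p q by (auto simp: poly_fun_add intro!: image_eqI[of _ _ "p + q"])
qed

text \<open>The factor enters each square as \<open>sqrt c\<close>. A constant polynomial has degree
  0, so the degree bound survives the product.\<close>

lemma sos_functions_scale:
  assumes "f \<in> sos_functions m" "0 \<le> c"
  shows "(\<lambda>x. c * f x) \<in> sos_functions m"
proof -
  obtain p where p: "f = poly_fun p" "p \<in> sos_polys m"
    using assms by blast
  obtain ps where ps: "p = (\<Sum>q\<leftarrow>ps. q\<^sup>2)"
    using p by (auto simp: sos_polys_def)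
  have "(Poly_Mapping.single 0 (sqrt c) :: 'a mpoly)\<^sup>2 = Poly_Mapping.single 0 c"
    using \<open>0 \<le> c\<close> by (simp add: power2_eq_square mult_single)
  then have "Poly_Mapping.single 0 c * p = (\<Sum>q\<leftarrow>map ((*) (Poly_Mapping.single 0 (sqrt c))) ps. q\<^sup>2)"
    by (simp add: ps o_def power_mult_distrib sum_list_const_mult)
  moreover have "total_degree (Poly_Mapping.single 0 c :: 'a mpoly) \<le> 0"
    by (simp only: total_degree_le_iff) (simp add: mon_degree_def)
  then have "total_degree (Poly_Mapping.single 0 c * p) \<le> 0 + m"
    using p by (intro total_degree_mult_le) (auto simp: sos_polys_def)
  ultimately have "Poly_Mapping.single 0 c * p \<in> sos_polys m"
    unfolding sos_polys_def by (simp del: map_map) blast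
  moreover have "poly_fun (Poly_Mapping.single 0 c * p) = (\<lambda>x. c * f x)"
    by (rule ext) (simp add: p poly_fun_mult poly_fun_single)
  ultimately show ?thesis
    by (metis image_eqI)
qed

lemma sos_functions_sum:
  "(\<And>j. j \<in> S \<Longrightarrow> f j \<in> sos_functions m) \<Longrightarrow> (\<lambda>x. \<Sum>j\<in>S. f j x) \<in> sos_functions m"
  by (induction S rule: infinite_finite_induct)
    (auto intro: sos_functions_zero sos_functions_add)

text \<open>Every square used below comes from this one, with a zero coefficient where a single
  monomial is wanted.\<close>

lemma sos_functions_binomial_square:
  assumes "sum a UNIV \<le> k" "sum b UNIV \<le> k"
  shows "(\<lambda>x. (u * vpow x a + v * vpow x b)\<^sup>2) \<in> sos_functions (2 * k)"
proof -
  \<comment> \<open>On a finite index type every exponent function has finite support, so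
    \<open>Abs_poly_mapping\<close> is faithful.\<close>
  define q where "q = Poly_Mapping.single (Abs_poly_mapping a) u +
      Poly_Mapping.single (Abs_poly_mapping b) v"
  have "total_degree q \<le> k"
    unfolding q_def by (intro total_degree_add_le)
      (use assms in \<open>auto simp: total_degree_le_iff mon_degree_def split: if_splits\<close>)
  then have "total_degree (q\<^sup>2) \<le> 2 * k"
    using total_degree_mult_le[of q k q k] by (simp add: power2_eq_square)
  moreover have "q\<^sup>2 = (\<Sum>p\<leftarrow>[q]. p\<^sup>2)"
    by simp
  ultimately have "q\<^sup>2 \<in> sos_polys (2 * k)"
    unfolding sos_polys_def by blast
  moreover have "poly_fun (q\<^sup>2) = (\<lambda>x. (u * vpow x a + v * vpow x b)\<^sup>2)"
    by (rule ext) (simp add: q_def poly_fun_power2 poly_fun_add poly_fun_single_vpow)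
  ultimately show ?thesis
    by (metis image_eqI)
qed

lemma sos_functions_square:
  assumes "sum a UNIV \<le> k"
  shows "(\<lambda>x. (vpow x a)\<^sup>2) \<in> sos_functions (2 * k)"
  using sos_functions_binomial_square[OF assms assms, of 1 0] by simp

lemma sos_functions_power:
  fixes i :: "'n::finite"
  shows "(\<lambda>x. (x $ i) ^ (2 * k)) \<in> sos_functions (2 * k)"
proof -
  have "vpow x (\<lambda>j. if j = i then k else 0) = x $ i ^ k" for x :: "real ^ 'n"
    using vpow_upd[of x "\<lambda>_. 0" i k] by (simp add: fun_upd_def)
  then show ?thesis
    using sos_functions_square[of "\<lambda>j. if j = i then k else 0" k]
    by (simp add: power_mult[symmetric] mult.commute)
qed

text \<open>Since the decomposition of \<open>h\<close> is asked for pointwise, a membership claim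
  comes down to an identity between real numbers.\<close>

lemma sos_functions_conic:
  assumes "f \<in> sos_functions m" "g \<in> sos_functions m" "0 \<le> a" "0 \<le> b"
    and "\<And>x. h x = a * f x + b * g x"
  shows "h \<in> sos_functions m"
proof -
  have "h = (\<lambda>x. a * f x + b * g x)"
    using assms(5) by (rule ext)
  then show ?thesis
    using assms(1-4) by (simp add: sos_functions_add sos_functions_scale)
qed

section \<open>Hurwitz's theorem: AM-GM forms are sums of squares\<close>

text \<open>When the second differences are sums of squares, \<open>q\<close> is convex modulo sums
  of squares, hence lies below the chord through its values at 0 and \<open>N\<close>. The chord
  inequality is multiplied by \<open>N\<close> to clear denominators.\<close>

lemma sos_functions_discrete_convex:
  fixes q :: "nat \<Rightarrow> real ^ 'n::finite \<Rightarrow> real"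
  assumes step: "\<And>t. Suc t < N \<Longrightarrow> (\<lambda>x. q t x + q (Suc (Suc t)) x - 2 * q (Suc t) x) \<in> sos_functions m"
    and "t \<le> N"
  shows "(\<lambda>x. real t * q N x + real (N - t) * q 0 x - real N * q t x) \<in> sos_functions m"
proof -
  \<comment> \<open>The chord inequality at \<open>t\<close> with right end \<open>Suc t\<close>.
    Passing from \<open>t\<close> to \<open>Suc t\<close> adds \<open>Suc t\<close> times a second
    difference.\<close>
  have A: "(\<lambda>x. real t * q (Suc t) x + q 0 x - real (Suc t) * q t x) \<in> sos_functions m" if "t < N" for t
    using that
  proof (induction t)
    case 0
    then show ?case by (simp add: sos_functions_zero)
  next
    case (Suc t)
    then show ?case
      by (intro sos_functions_conic[OF step[of t] Suc.IH, of "real (Suc t)" 1])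
        (auto simp: algebra_simps)
  qed
  \<comment> \<open>The right end \<open>M\<close> now moves away from \<open>t\<close>. Fact
    \<open>A\<close> at \<open>M\<close> and the chord inequality with right end \<open>M\<close>
    are weighted so that \<open>q M\<close> cancels.\<close>
  have "M \<le> N \<longrightarrow> (\<lambda>x. real t * q M x + real (M - t) * q 0 x - real M * q t x) \<in> sos_functions m"
    if "t \<le> M" for M
    using that
  proof (induction M rule: dec_induct)
    case base
    then show ?case by (simp add: sos_functions_zero)
  next
    case (step M)
    show ?case
    proof
      assume "Suc M \<le> N"
      show "(\<lambda>x. real t * q (Suc M) x + real (Suc M - t) * q 0 x - real (Suc M) * q t x) \<in> sos_functions m"
      proof (cases "M = 0")
        \<comment> \<open>Here \<open>t = 0\<close> too and the expression vanishes; the identity of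
          the other case divides by \<open>M\<close>.\<close>
        case True
        then show ?thesis using step by (simp add: sos_functions_zero)
      next
        case False
        have eq: "real t * q (Suc M) x + real (Suc M - t) * q 0 x - real (Suc M) * q t x =
            (real t / M) * (real M * q (Suc M) x + q 0 x - real (Suc M) * q M x) +
            (Suc M / M) * (real t * q M x + real (M - t) * q 0 x - real M * q t x)" for x
          using False step(1) by (simp add: of_nat_diff field_simps)
        show ?thesis
          by (rule sos_functions_conic[OF A[of M] _ _ _ eq])
            (use step \<open>Suc M \<le> N\<close> in auto)
      qed
    qed
  qed
  then show ?thesis using \<open>t \<le> N\<close> by blast
qed

text \<open>Hurwitz's theorem for even exponents: moving weight between two coordinates of the exponent
  produces a convex sequence modulo squares, which reduces the support of the exponent.\<close>

lemma sos_functions_AMGM_even: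
  fixes d :: "'n::finite \<Rightarrow> nat"
  assumes "sum d UNIV = k" "k > 0"
  shows "(\<lambda>x. (\<Sum>i\<in>UNIV. real (d i) / real k * (z $ i * x $ i) ^ (2 * k)) - (vpow (z * x) d)\<^sup>2)
    \<in> sos_functions (2 * k)"
  using assms(1)
proof (induction "card {i. d i \<noteq> 0}" arbitrary: d rule: less_induct)
  case less
  obtain i where i: "d i \<noteq> 0"
    using less.prems \<open>k > 0\<close> by (metis less_irrefl sum.neutral)
  show ?case
  proof (cases "\<exists>j. j \<noteq> i \<and> d j \<noteq> 0")
    \<comment> \<open>The support is a single point, and the difference is identically 0.\<close>
    case False
    then have "sum d (UNIV - {i}) = 0" by auto
    then have "d i = k"
      using less.prems by (simp add: sum.remove[of UNIV i])
    then have d: "d = (\<lambda>j. if j = i then k else 0)"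
      using False by (auto simp: fun_eq_iff)
    have "vpow x d = x $ i ^ k" for x :: "real ^ 'n"
      using vpow_upd[of x "\<lambda>_. 0" i k] by (simp add: fun_upd_def d)
    then have "(\<Sum>i\<in>UNIV. real (d i) / real k * (z $ i * x $ i) ^ (2 * k)) - (vpow (z * x) d)\<^sup>2 = 0" for x
      using \<open>k > 0\<close> by (subst sum.remove[of _ i]) (auto simp: d power_mult[symmetric] mult.commute)
    then show ?thesis
      by (simp add: sos_functions_zero)
  next
    case True
    then obtain j where j: "j \<noteq> i" "d j \<noteq> 0" by blast
    define N where "N = d i + d j"
    \<comment> \<open>The joint weight \<open>N\<close> of \<open>i\<close> and \<open>j\<close> is
      redistributed. At \<open>t = d i\<close> this gives back \<open>d\<close>; at
      \<open>t = 0\<close> and \<open>t = N\<close> one of the two coordinates leaves the support,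
      so the induction hypothesis applies.\<close>
    define e where "e t = d(i := t, j := N - t)" for t
    define P where "P t x = (\<Sum>l\<in>UNIV. real (e t l) / real k * (z $ l * x $ l) ^ (2 * k))" for t x
    define q where "q t x = (vpow (z * x) (e t))\<^sup>2" for t and x :: "real ^ 'n"
    have e_sum: "sum (e t) UNIV = k" if "t \<le> N" for t
    proof -
      have split: "sum f UNIV = f i + (f j + sum f (UNIV - {i} - {j}))" for f :: "'n \<Rightarrow> nat"
        using j by (subst sum.remove[of _ i], simp, simp, subst sum.remove[of _ j]) auto
      have "sum (e t) (UNIV - {i} - {j}) = sum d (UNIV - {i} - {j})"
        by (intro sum.cong) (auto simp: e_def)
      then show ?thesis
        using that j split[of d] split[of "e t"] less.prems by (simp add: e_def N_def)
    qed
    have e_d: "e (d i) = d"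
      using j by (auto simp: e_def N_def fun_eq_iff)
    have IH: "(\<lambda>x. P t x - q t x) \<in> sos_functions (2 * k)" if "t = 0 \<or> t = N" for t
    proof -
      have "{l. e t l \<noteq> 0} \<subset> {l. d l \<noteq> 0}"
        using that i j by (auto simp: e_def split: if_splits)
      then have "card {l. e t l \<noteq> 0} < card {l. d l \<noteq> 0}"
        by (intro psubset_card_mono) auto
      moreover have "t \<le> N" using that by auto
      ultimately show ?thesis
        unfolding P_def q_def using less.hyps e_sum by blast
    qed
    have convex: "(\<lambda>x. q t x + q (Suc (Suc t)) x - 2 * q (Suc t) x) \<in> sos_functions (2 * k)"
      if "Suc t < N" for t
    proof -
      \<comment> \<open>\<open>e (Suc t)\<close> is the midpoint of its two neighbours, so the
        second difference of the squares is the square of the difference of the outer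
        monomials.\<close>
      have v: "vpow y (e t) * vpow y (e (Suc (Suc t))) = (vpow y (e (Suc t)))\<^sup>2" for y
      proof -
        have "e t l + e (Suc (Suc t)) l = 2 * e (Suc t) l" for l
          using that j by (auto simp: e_def)
        then show ?thesis
          by (simp add: vpow_add[symmetric] vpow_double[symmetric])
      qed
      have "q t x + q (Suc (Suc t)) x - 2 * q (Suc t) x =
          (vpow z (e t) * vpow x (e t) + (- vpow z (e (Suc (Suc t)))) * vpow x (e (Suc (Suc t))))\<^sup>2" for x
        using v[of "z * x"] by (simp add: q_def vpow_mult power2_diff algebra_simps)
      moreover have "sum (e t) UNIV \<le> k" "sum (e (Suc (Suc t))) UNIV \<le> k"
        using that by (simp_all add: e_sum)
      ultimately show ?thesis
        by (simp only: sos_functions_binomial_square)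
    qed
    have "N > 0" and le: "d i \<le> N" using i by (auto simp: N_def)
    \<comment> \<open>The diagonal part is affine in \<open>t\<close> and equals its chord, while
      \<open>q\<close> lies below its chord modulo squares. So the claim at \<open>d i\<close>
      follows from those at the two ends.\<close>
    have lin: "P (d i) x = real (d i) / N * P N x + real (N - d i) / N * P 0 x" for x
    proof -
      have "real (e (d i) l) = real (d i) / N * e N l + real (N - d i) / N * e 0 l" for l
        using \<open>N > 0\<close> le j by (simp add: e_def of_nat_diff field_simps)
      then show ?thesis
        unfolding P_def sum_distrib_left sum.distrib[symmetric]
        by (intro sum.cong refl) (simp add: add_divide_distrib distrib_right)
    qed
    define f where "f x = real (d i) / N * (P N x - q N x) + real (N - d i) / N * (P 0 x - q 0 x)" for x
    have f: "f \<in> sos_functions (2 * k)"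
      by (rule sos_functions_conic[OF IH[of N] IH[of 0], of "real (d i) / N" "real (N - d i) / N"])
        (auto simp: f_def mult.commute)
    have "(\<lambda>x. P (d i) x - q (d i) x) \<in> sos_functions (2 * k)"
    proof (rule sos_functions_conic[OF f sos_functions_discrete_convex[where q = q, OF convex le], of 1 "1 / N"])
      fix x
      have combine: "p - w = 1 * (\<alpha> * (p1 - q1) + \<beta> * (p0 - q0)) + r"
        if "p = \<alpha> * p1 + \<beta> * p0" "r = \<alpha> * q1 + \<beta> * q0 - w" for p w \<alpha> \<beta> p1 p0 q1 q0 r :: real
        using that by (simp add: algebra_simps)
      show "P (d i) x - q (d i) x =
          1 * f x + 1 / N * (real (d i) * q N x + real (N - d i) * q 0 x - real N * q (d i) x)"
        unfolding f_def by (rule combine[OF lin]) (use \<open>N > 0\<close> in \<open>simp add: field_simps\<close>)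
    qed auto
    then show ?thesis
      unfolding P_def q_def e_d .
  qed
qed

text \<open>Serves to halve an exponent of degree \<open>2 * k\<close>; the sub-exponent grows by
  one unit at a time.\<close>

lemma exists_sub_exponent:
  fixes a :: "'n::finite \<Rightarrow> nat"
  assumes "k \<le> sum a UNIV"
  shows "\<exists>b. (\<forall>i. b i \<le> a i) \<and> sum b UNIV = k"
  using assms
proof (induction k)
  case 0
  show ?case by (intro exI[of _ "\<lambda>_. 0"]) auto
next
  case (Suc k)
  then obtain b where b: "\<And>i. b i \<le> a i" "sum b UNIV = k" by auto
  have "\<exists>i. b i < a i"
  proof (rule ccontr)
    assume "\<not> (\<exists>i. b i < a i)"
    then have "sum a UNIV \<le> sum b UNIV" by (intro sum_mono) (simp add: not_less)
    then show False using b Suc.prems by simp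
  qed
  then obtain i where "b i < a i" ..
  moreover have "sum (b(i := Suc (b i))) UNIV = Suc k"
    using b(2) by (simp add: sum.remove[of UNIV i])
  ultimately show ?case
    using b(1) by (intro exI[of _ "b(i := Suc (b i))"]) auto
qed

text \<open>Write \<open>a = b + c\<close> with both parts of degree \<open>k\<close>. The mixed
  term is then the cross term of the square of
  \<open>vpow (z * x) b + \<sigma> * vpow (z * x) c\<close>, and the even case pays for the two pure
  squares. What is left over is \<open>1 - \<sigma>\<^sup>2\<close> times a square, nonnegative as
  \<open>\<bar>\<sigma>\<bar> \<le> 1\<close>.\<close>

lemma sos_functions_AMGM:
  fixes a :: "'n::finite \<Rightarrow> nat"
  assumes a: "sum a UNIV = 2 * k" and "k > 0" and \<sigma>: "\<bar>\<sigma>\<bar> \<le> 1"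
  shows "(\<lambda>x. (\<Sum>i\<in>UNIV. real (a i) / real (2 * k) * (z $ i * x $ i) ^ (2 * k)) + \<sigma> * vpow (z * x) a)
    \<in> sos_functions (2 * k)"
proof -
  obtain b where b: "\<And>i. b i \<le> a i" "sum b UNIV = k"
    using exists_sub_exponent[of k a] a by auto
  define c where "c i = a i - b i" for i
  have abc: "a i = b i + c i" for i
    using b by (simp add: c_def)
  have c: "sum c UNIV = k"
    using a b(2) by (simp add: abc sum.distrib)
  define P where "P d x = (\<Sum>i\<in>UNIV. real (d i) / real k * (z $ i * x $ i) ^ (2 * k)) - (vpow (z * x) d)\<^sup>2"
    for d and x :: "real ^ 'n"
  have P: "(\<lambda>x. P d x) \<in> sos_functions (2 * k)" if "sum d UNIV = k" for d
    unfolding P_def using sos_functions_AMGM_even[OF that \<open>k > 0\<close>] .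
  have "\<sigma>\<^sup>2 \<le> 1"
    using \<sigma> abs_square_le_1 by blast
  have sq: "(\<lambda>x. (vpow z b * vpow x b + (\<sigma> * vpow z c) * vpow x c)\<^sup>2) \<in> sos_functions (2 * k)"
    using b c by (intro sos_functions_binomial_square) auto
  have sq': "(\<lambda>x. (0 * vpow x b + vpow z c * vpow x c)\<^sup>2) \<in> sos_functions (2 * k)"
    using b c by (intro sos_functions_binomial_square) auto
  have *: "(\<Sum>i\<in>UNIV. real (a i) / real (2 * k) * (z $ i * x $ i) ^ (2 * k)) + \<sigma> * vpow (z * x) a =
      1 / 2 * (1 * P b x + 1 * P c x) +
      1 / 2 * (1 * (vpow z b * vpow x b + (\<sigma> * vpow z c) * vpow x c)\<^sup>2 +
        (1 - \<sigma>\<^sup>2) * (0 * vpow x b + vpow z c * vpow x c)\<^sup>2)" for x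
  proof -
    have "(\<Sum>i\<in>UNIV. real (a i) / real (2 * k) * (z $ i * x $ i) ^ (2 * k)) =
      1 / 2 * ((\<Sum>i\<in>UNIV. real (b i) / real k * (z $ i * x $ i) ^ (2 * k)) +
        (\<Sum>i\<in>UNIV. real (c i) / real k * (z $ i * x $ i) ^ (2 * k)))"
      unfolding sum.distrib[symmetric] sum_distrib_left
      using \<open>k > 0\<close> by (intro sum.cong refl) (simp add: abc field_simps)
    moreover have "vpow (z * x) a = vpow (z * x) b * vpow (z * x) c"
      by (simp add: abc[abs_def] vpow_add)
    ultimately show ?thesis
      by (simp add: P_def vpow_mult power2_sum power_mult_distrib algebra_simps)
  qed
  show ?thesis
    by (rule sos_functions_conic[OF sos_functions_conic[OF P[OF b(2)] P[OF c] _ _ refl]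
          sos_functions_conic[OF sq sq' _ _ refl] _ _ *])
      (use \<open>\<sigma>\<^sup>2 \<le> 1\<close> in auto)
qed

text \<open>Rescaling the variables by \<open>z\<close> turns the weights \<open>w i\<close> into
  the AM-GM weights \<open>a i / (2 * k)\<close>. The bound on \<open>b\<close> then says that
  \<open>b\<close> is at most \<open>vpow z a\<close> in absolute value; it is stated with powers to
  avoid roots. Coordinates with \<open>a i = 0\<close> contribute the factor 1 to it.\<close>

lemma sos_functions_weighted_AMGM:
  fixes a :: "'n::finite \<Rightarrow> nat"
  assumes a: "sum a UNIV = 2 * k" and "k > 0" and w: "\<And>i. 0 \<le> w i"
    and b: "\<bar>b\<bar> ^ (2 * k) \<le> (\<Prod>i\<in>UNIV. (real (2 * k) * w i / real (a i)) ^ a i)"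
  shows "(\<lambda>x. (\<Sum>i\<in>UNIV. w i * (x $ i) ^ (2 * k)) + b * vpow x a) \<in> sos_functions (2 * k)"
proof (cases "b = 0")
  case True
  have "(\<lambda>x. \<Sum>i\<in>UNIV. w i * (x $ i) ^ (2 * k)) \<in> sos_functions (2 * k)"
    using w by (intro sos_functions_sum sos_functions_scale sos_functions_power)
  then show ?thesis using True by simp
next
  case False
  define z :: "real ^ 'n" where
    "z = (\<chi> i. if a i = 0 then 1 else root (2 * k) (real (2 * k) * w i / real (a i)))"
  \<comment> \<open>As \<open>b\<close> is nonzero, the bound forces \<open>w i\<close> to be
    positive wherever \<open>a i\<close> is; hence all entries of \<open>z\<close> are positive and
    \<open>b\<close> can be divided by \<open>vpow z a\<close>.\<close>
  have prod_pos: "0 < (\<Prod>i\<in>UNIV. (real (2 * k) * w i / real (a i)) ^ a i)"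
    using b False by (smt (verit) zero_less_power zero_less_abs_iff)
  have w_pos: "0 < w i" if "a i \<noteq> 0" for i
  proof (rule ccontr)
    assume "\<not> 0 < w i"
    then have "w i = 0" using w[of i] by simp
    then have "(\<Prod>i\<in>UNIV. (real (2 * k) * w i / real (a i)) ^ a i) = 0"
      using that by (intro prod_zero) (auto intro!: bexI[of _ i])
    then show False using prod_pos by linarith
  qed
  have z_power: "(z $ i) ^ (2 * k) = real (2 * k) * w i / real (a i)" if "a i \<noteq> 0" for i
    using that w[of i] \<open>k > 0\<close> by (simp add: z_def)
  have z_pos: "0 < z $ i" for i
    using w_pos[of i] \<open>k > 0\<close> by (simp add: z_def)
  then have Z: "0 < vpow z a"
    by (rule vpow_pos)
  have "(vpow z a) ^ (2 * k) = (\<Prod>i\<in>UNIV. ((z $ i) ^ (2 * k)) ^ a i)"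
    by (simp add: vpow_def prod_power_distrib power_mult[symmetric] mult.commute)
  also have "\<dots> = (\<Prod>i\<in>UNIV. (real (2 * k) * w i / real (a i)) ^ a i)"
  proof (intro prod.cong refl)
    show "((z $ i) ^ (2 * k)) ^ a i = (real (2 * k) * w i / real (a i)) ^ a i" for i
      using z_power[of i] by (cases "a i = 0") simp_all
  qed
  finally have "\<bar>b\<bar> ^ (2 * k) \<le> (vpow z a) ^ (2 * k)"
    using b by simp
  then have "\<bar>b\<bar> \<le> vpow z a"
    by (rule iffD1[OF power_mono_iff[OF abs_ge_zero less_imp_le[OF Z]], rotated]) (use \<open>k > 0\<close> in simp)
  then have \<sigma>: "\<bar>b / vpow z a\<bar> \<le> 1"
    using Z by (simp add: abs_divide abs_of_pos)
  have rest: "(\<lambda>x. \<Sum>i\<in>UNIV. (if a i = 0 then w i else 0) * (x $ i) ^ (2 * k)) \<in> sos_functions (2 * k)"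
    using w by (intro sos_functions_sum sos_functions_scale sos_functions_power) auto
  have "(\<Sum>i\<in>UNIV. w i * (x $ i) ^ (2 * k)) + b * vpow x a =
      1 * ((\<Sum>i\<in>UNIV. real (a i) / real (2 * k) * (z $ i * x $ i) ^ (2 * k)) + b / vpow z a * vpow (z * x) a) +
      1 * (\<Sum>i\<in>UNIV. (if a i = 0 then w i else 0) * (x $ i) ^ (2 * k))" for x
  proof -
    have "(\<Sum>i\<in>UNIV. w i * (x $ i) ^ (2 * k)) =
      (\<Sum>i\<in>UNIV. real (a i) / real (2 * k) * (z $ i * x $ i) ^ (2 * k)) +
      (\<Sum>i\<in>UNIV. (if a i = 0 then w i else 0) * (x $ i) ^ (2 * k))"
      unfolding sum.distrib[symmetric]
      by (intro sum.cong refl) (use \<open>k > 0\<close> z_power in \<open>auto simp: power_mult_distrib\<close>)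
    then show ?thesis
      using Z by (simp add: vpow_mult)
  qed
  then show ?thesis
    by (intro sos_functions_conic[OF sos_functions_AMGM[OF a \<open>k > 0\<close> \<sigma>] rest, of 1 1]) auto
qed

section \<open>Splitting the diagonal part among the off-diagonal monomials\<close>

text \<open>Minimise over the orthant the form perturbed by \<open>\<epsilon> * (\<Sum>i. x i ^ m) - (\<Sum>i. x i)\<close>. The linear term
  forces all coordinates of the minimiser to be positive, and nonnegativity of the one-sided partial
  derivatives, multiplied by the coordinates, is the claimed inequality.\<close>

lemma exists_positive_subcritical_point:
  fixes c :: "'n::finite \<Rightarrow> real" and e :: "'j \<Rightarrow> 'n \<Rightarrow> nat"
  assumes "1 < m" and b: "\<And>j. j \<in> S \<Longrightarrow> 0 \<le> b j"
    and nonneg: "\<And>x. (\<And>i. 0 \<le> x $ i) \<Longrightarrow>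
      0 \<le> (\<Sum>i\<in>UNIV. c i * (x $ i) ^ m) - (\<Sum>j\<in>S. b j * vpow x (e j))"
    and "0 < \<epsilon>"
  shows "\<exists>y. (\<forall>i. 0 < y $ i) \<and>
    (\<forall>i. (\<Sum>j\<in>S. b j * real (e j i) * vpow y (e j)) \<le> real m * (c i + \<epsilon>) * (y $ i) ^ m)"
proof -
  define n where "n = real CARD('n)"
  \<comment> \<open>\<open>R\<close> is so large that on a face \<open>y $ i = R\<close> the term
    \<open>\<epsilon> * R ^ m - R\<close> is at least \<open>n * R\<close>. This outweighs the other
    \<open>n - 1\<close> coordinates, which contribute at least \<open>- R\<close> each, so
    \<open>\<Phi>\<close> is positive there whereas \<open>\<Phi> 0 \<le> 0\<close>.\<close>
  define R where "R = max 1 ((n + 1) / \<epsilon>)"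
  have "1 \<le> R" by (simp add: R_def)
  have R: "(n + 1) \<le> \<epsilon> * R"
    using \<open>0 < \<epsilon>\<close> by (simp add: R_def field_simps max_def)
  define \<Phi> where "\<Phi> x = (\<Sum>i\<in>UNIV. (c i + \<epsilon>) * (x $ i) ^ m) - (\<Sum>j\<in>S. b j * vpow x (e j)) - (\<Sum>i\<in>UNIV. x $ i)"
    for x :: "real ^ 'n"
  define B :: "(real ^ 'n) set" where "B = cbox 0 (\<chi> i. R)"
  have B: "x \<in> B \<longleftrightarrow> (\<forall>i. 0 \<le> x $ i \<and> x $ i \<le> R)" for x
    by (simp add: B_def mem_box_cart)
  have "continuous_on B \<Phi>"
    unfolding \<Phi>_def by (intro continuous_intros)
  moreover have zero: "0 \<in> B" using \<open>1 \<le> R\<close> by (simp add: B)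
  ultimately obtain y where y: "y \<in> B" and min: "\<And>x. x \<in> B \<Longrightarrow> \<Phi> y \<le> \<Phi> x"
    using continuous_attains_inf[of B \<Phi>] by (auto simp: B_def)
  have "vpow 0 (e j) \<ge> 0" for j by (simp add: vpow_nonneg)
  then have "\<Phi> 0 \<le> 0"
    using b \<open>1 < m\<close> by (simp add: \<Phi>_def power_0_left sum_nonneg)
  then have \<Phi>y: "\<Phi> y \<le> 0" using min[OF zero] by simp
  have y_less: "y $ i < R" for i
  proof (rule ccontr)
    assume "\<not> y $ i < R"
    then have yi: "y $ i = R" using y by (simp add: B antisym)
    have "R\<^sup>2 \<le> R ^ m" using \<open>1 \<le> R\<close> \<open>1 < m\<close> by (intro power_increasing) auto
    then have "\<epsilon> * R\<^sup>2 \<le> \<epsilon> * R ^ m" using \<open>0 < \<epsilon>\<close> by simp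
    moreover have "(n + 1) * R \<le> \<epsilon> * R * R"
      using R \<open>1 \<le> R\<close> by (intro mult_right_mono) auto
    ultimately have hR: "n * R \<le> \<epsilon> * R ^ m - R"
      by (simp add: power2_eq_square algebra_simps)
    have "- R \<le> \<epsilon> * (y $ l) ^ m - y $ l" for l
      using y \<open>0 < \<epsilon>\<close> by (smt (verit) B mult_nonneg_nonneg zero_le_power)
    then have "(\<Sum>l\<in>UNIV - {i}. - R) \<le> (\<Sum>l\<in>UNIV - {i}. \<epsilon> * (y $ l) ^ m - y $ l)"
      by (intro sum_mono) auto
    moreover have "(\<Sum>l\<in>UNIV - {i}. - R) = - (n - 1) * R"
      by (simp add: n_def card_Diff_singleton of_nat_diff Suc_le_eq algebra_simps)
    moreover have "(\<Sum>l\<in>UNIV. \<epsilon> * (y $ l) ^ m - y $ l) =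
        (\<epsilon> * R ^ m - R) + (\<Sum>l\<in>UNIV - {i}. \<epsilon> * (y $ l) ^ m - y $ l)"
      by (subst sum.remove[of _ i]) (auto simp: yi)
    ultimately have "0 < (\<Sum>l\<in>UNIV. \<epsilon> * (y $ l) ^ m - y $ l)"
      using hR \<open>1 \<le> R\<close> by (simp add: algebra_simps)
    moreover have "\<Phi> y = ((\<Sum>i\<in>UNIV. c i * (y $ i) ^ m) - (\<Sum>j\<in>S. b j * vpow y (e j))) +
        (\<Sum>l\<in>UNIV. \<epsilon> * (y $ l) ^ m - y $ l)"
      by (simp add: \<Phi>_def algebra_simps sum.distrib sum_subtractf)
    ultimately show False
      using \<Phi>y nonneg[of y] y by (auto simp: B)
  qed
  define rest where "rest j i = (\<Prod>l\<in>UNIV - {i}. (y $ l) ^ e j l)" for j i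
  \<comment> \<open>The partial derivative of \<open>\<Phi>\<close> at \<open>y\<close> in direction
    \<open>i\<close>. Where \<open>e j i = 0\<close>, the truncated exponent
    \<open>e j i - 1\<close> is harmless because of the factor \<open>real (e j i)\<close>.\<close>
  define D where "D i = (c i + \<epsilon>) * (real m * (y $ i) ^ (m - 1)) -
      (\<Sum>j\<in>S. b j * (real (e j i) * (y $ i) ^ (e j i - 1) * rest j i)) - 1" for i
  \<comment> \<open>Only increments to the right are sure to stay in the box, as
    \<open>y $ i\<close> may still be 0; \<open>y_less\<close> leaves room for them.\<close>
  have D: "0 \<le> D i" for i
  proof (rule ccontr)
    assume "\<not> 0 \<le> D i"
    define u where "u t = (\<chi> l. if l = i then t else y $ l)" for t
    define K where "K = (\<Sum>l\<in>UNIV - {i}. (c l + \<epsilon>) * (y $ l) ^ m) - (\<Sum>l\<in>UNIV - {i}. y $ l)"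
    have \<Phi>u: "\<Phi> (u t) = (c i + \<epsilon>) * t ^ m - (\<Sum>j\<in>S. b j * (t ^ e j i * rest j i)) - t + K" for t
    proof -
      have split: "(\<Sum>l\<in>UNIV. g l (u t $ l)) = g i t + (\<Sum>l\<in>UNIV - {i}. g l (y $ l))" for g :: "'n \<Rightarrow> real \<Rightarrow> real"
        by (subst sum.remove[of _ i]) (auto simp: u_def)
      show ?thesis
        unfolding \<Phi>_def split[of "\<lambda>l s. (c l + \<epsilon>) * s ^ m"] split[of "\<lambda>l s. s"]
        by (simp add: u_def vpow_at K_def rest_def)
    qed
    have "((\<lambda>t. \<Phi> (u t)) has_real_derivative D i) (at (y $ i))"
      unfolding \<Phi>u D_def by (auto intro!: derivative_eq_intros sum.cong)
    then obtain d where d: "d > 0" "\<And>h. 0 < h \<Longrightarrow> h < d \<Longrightarrow> \<Phi> (u (y $ i)) > \<Phi> (u (y $ i + h))"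
      using DERIV_neg_dec_right[of "\<lambda>t. \<Phi> (u t)"] \<open>\<not> 0 \<le> D i\<close> by (meson not_le)
    define h where "h = min (d / 2) (R - y $ i)"
    have h: "0 < h" "h < d" "y $ i + h \<le> R"
      using \<open>d > 0\<close> y_less[of i] by (auto simp: h_def)
    have "u (y $ i + h) \<in> B"
      using y h by (auto simp: B u_def add_nonneg_nonneg)
    moreover have "u (y $ i) = y"
      by (simp add: u_def vec_eq_iff)
    ultimately show False
      using min d(2)[of h] h by force
  qed
  \<comment> \<open>At \<open>y $ i = 0\<close> the diagonal term of \<open>D i\<close> vanishes
    because \<open>1 < m\<close>, so the linear perturbation gives
    \<open>D i \<le> - 1\<close>.\<close>
  have y_pos: "0 < y $ i" for i
  proof (rule ccontr)
    assume "\<not> 0 < y $ i"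
    then have "y $ i = 0" using y by (simp add: B antisym)
    moreover have "0 \<le> (\<Sum>j\<in>S. b j * (real (e j i) * (y $ i) ^ (e j i - 1) * rest j i))"
      using b y by (intro sum_nonneg mult_nonneg_nonneg) (auto simp: rest_def B intro!: prod_nonneg)
    moreover have "(c i + \<epsilon>) * (real m * (y $ i) ^ (m - 1)) = 0"
      using \<open>y $ i = 0\<close> \<open>1 < m\<close> by simp
    ultimately show False
      using D[of i] unfolding D_def by linarith
  qed
  have "(\<Sum>j\<in>S. b j * real (e j i) * vpow y (e j)) \<le> real m * (c i + \<epsilon>) * (y $ i) ^ m" for i
  proof -
    have pow: "y $ i * (y $ i) ^ (p - 1) * real p = real p * (y $ i) ^ p" for p
      by (cases p) auto
    have "y $ i * (\<Sum>j\<in>S. b j * (real (e j i) * (y $ i) ^ (e j i - 1) * rest j i)) =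
        (\<Sum>j\<in>S. b j * rest j i * (y $ i * (y $ i) ^ (e j i - 1) * real (e j i)))"
      unfolding sum_distrib_left by (intro sum.cong) auto
    also have "\<dots> = (\<Sum>j\<in>S. b j * real (e j i) * vpow y (e j))"
      unfolding pow rest_def by (intro sum.cong refl) (simp add: vpow_remove[of y _ i])
    finally have "y $ i * D i = (c i + \<epsilon>) * (y $ i * (y $ i) ^ (m - 1) * real m) -
        (\<Sum>j\<in>S. b j * real (e j i) * vpow y (e j)) - y $ i"
      by (simp add: D_def algebra_simps)
    moreover have "0 \<le> y $ i * D i"
      using D[of i] y_pos[of i] by simp
    ultimately show ?thesis
      unfolding pow using y_pos[of i] by (simp add: algebra_simps)
  qed
  then show ?thesis using y_pos by blast
qed

text \<open>Each monomial receives the share of the diagonal for which its AM-GM inequality is tight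
  at the point \<open>y\<close>. The inequality satisfied by \<open>y\<close> then says precisely
  that the shares do not exceed the perturbed diagonal.\<close>

lemma exists_weights_perturbed:
  fixes c :: "'n::finite \<Rightarrow> real" and e :: "'j \<Rightarrow> 'n \<Rightarrow> nat"
  assumes "1 < m" and b: "\<And>j. j \<in> S \<Longrightarrow> 0 \<le> b j" and e: "\<And>j. j \<in> S \<Longrightarrow> sum (e j) UNIV = m"
    and nonneg: "\<And>x. (\<And>i. 0 \<le> x $ i) \<Longrightarrow>
      0 \<le> (\<Sum>i\<in>UNIV. c i * (x $ i) ^ m) - (\<Sum>j\<in>S. b j * vpow x (e j))"
    and "0 < \<epsilon>"
  shows "\<exists>w. (\<forall>j\<in>S. \<forall>i. 0 \<le> w (j, i)) \<and> (\<forall>i. (\<Sum>j\<in>S. w (j, i)) \<le> c i + \<epsilon>) \<and>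
    (\<forall>j\<in>S. b j ^ m \<le> (\<Prod>i\<in>UNIV. (real m * w (j, i) / real (e j i)) ^ e j i))"
proof -
  obtain y where y: "\<And>i. 0 < y $ i"
    and crit: "\<And>i. (\<Sum>j\<in>S. b j * real (e j i) * vpow y (e j)) \<le> real m * (c i + \<epsilon>) * (y $ i) ^ m"
    using exists_positive_subcritical_point[OF assms(1,2,4,5)] by blast
  \<comment> \<open>Chosen so that \<open>real m * w (j, i) / real (e j i) * (y $ i) ^ m\<close> has
    the same value \<open>b j * vpow y (e j)\<close> for all \<open>i\<close> with
    \<open>e j i \<noteq> 0\<close>. Since the exponents sum to \<open>m\<close>, the product of the
    powers collapses to \<open>b j ^ m\<close>.\<close>
  define w where "w = (\<lambda>(j, i). b j * real (e j i) * vpow y (e j) / (real m * (y $ i) ^ m))"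
  have "0 \<le> w (j, i)" if "j \<in> S" for j i
    using b[OF that] vpow_pos[of y "e j"] y less_imp_le[OF y] by (simp add: w_def)
  moreover have "(\<Sum>j\<in>S. w (j, i)) \<le> c i + \<epsilon>" for i
    using crit[of i] y[of i] \<open>1 < m\<close>
    by (simp add: w_def sum_divide_distrib[symmetric] pos_divide_le_eq mult_ac)
  moreover have "b j ^ m = (\<Prod>i\<in>UNIV. (real m * w (j, i) / real (e j i)) ^ e j i)" if "j \<in> S" for j
  proof -
    have "(\<Prod>i\<in>UNIV. (real m * w (j, i) / real (e j i)) ^ e j i) =
        (\<Prod>i\<in>UNIV. (b j * vpow y (e j)) ^ e j i / ((y $ i) ^ e j i) ^ m)"
    proof (intro prod.cong refl)
      fix i
      show "(real m * w (j, i) / real (e j i)) ^ e j i = (b j * vpow y (e j)) ^ e j i / ((y $ i) ^ e j i) ^ m"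
        using \<open>1 < m\<close> by (cases "e j i = 0")
          (simp_all add: w_def power_divide power_mult[symmetric] mult.commute)
    qed
    also have "\<dots> = (b j * vpow y (e j)) ^ m / (vpow y (e j)) ^ m"
      by (simp add: prod_dividef power_sum[symmetric] e[OF that] prod_power_distrib[symmetric] vpow_def)
    also have "\<dots> = b j ^ m"
      using vpow_pos[of y "e j"] y by (simp add: power_mult_distrib)
    finally show ?thesis ..
  qed
  ultimately show ?thesis by (intro exI[of _ w]) auto
qed

text \<open>The weights for perturbations tending to 0 stay bounded, and all three conditions are
  closed, so a limit point of the weights satisfies them without perturbation.\<close>

lemma exists_weights:
  fixes c :: "'n::finite \<Rightarrow> real" and e :: "'j \<Rightarrow> 'n \<Rightarrow> nat"
  assumes "finite S" "1 < m" and b: "\<And>j. j \<in> S \<Longrightarrow> 0 \<le> b j" and e: "\<And>j. j \<in> S \<Longrightarrow> sum (e j) UNIV = m"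
    and nonneg: "\<And>x. (\<And>i. 0 \<le> x $ i) \<Longrightarrow>
      0 \<le> (\<Sum>i\<in>UNIV. c i * (x $ i) ^ m) - (\<Sum>j\<in>S. b j * vpow x (e j))"
  shows "\<exists>w. (\<forall>j\<in>S. \<forall>i. 0 \<le> w (j, i)) \<and> (\<forall>i. (\<Sum>j\<in>S. w (j, i)) \<le> c i) \<and>
    (\<forall>j\<in>S. b j ^ m \<le> (\<Prod>i\<in>UNIV. (real m * w (j, i) / real (e j i)) ^ e j i))"
proof -
  define \<epsilon> where "\<epsilon> N = inverse (real (Suc N))" for N
  have \<epsilon>: "0 < \<epsilon> N" "\<epsilon> N \<le> 1" for N
    by (simp_all add: \<epsilon>_def inverse_le_1_iff)
  have "\<forall>N. \<exists>w. (\<forall>j\<in>S. \<forall>i. 0 \<le> w (j, i)) \<and> (\<forall>i. (\<Sum>j\<in>S. w (j, i)) \<le> c i + \<epsilon> N) \<and>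
    (\<forall>j\<in>S. b j ^ m \<le> (\<Prod>i\<in>UNIV. (real m * w (j, i) / real (e j i)) ^ e j i))"
  proof
    fix N
    show "\<exists>w. (\<forall>j\<in>S. \<forall>i. 0 \<le> w (j, i)) \<and> (\<forall>i. (\<Sum>j\<in>S. w (j, i)) \<le> c i + \<epsilon> N) \<and>
      (\<forall>j\<in>S. b j ^ m \<le> (\<Prod>i\<in>UNIV. (real m * w (j, i) / real (e j i)) ^ e j i))"
      by (rule exists_weights_perturbed[OF assms(2-5) \<epsilon>(1)])
  qed
  from choice[OF this] obtain W where W: "\<And>N j i. j \<in> S \<Longrightarrow> 0 \<le> W N (j, i)"
    "\<And>N i. (\<Sum>j\<in>S. W N (j, i)) \<le> c i + \<epsilon> N"
    "\<And>N j. j \<in> S \<Longrightarrow> b j ^ m \<le> (\<Prod>i\<in>UNIV. (real m * W N (j, i) / real (e j i)) ^ e j i)"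
    by blast
  define V where "V = S \<times> (UNIV :: 'n set)"
  \<comment> \<open>A nonnegative weight is at most its sum over \<open>S\<close>, hence at most
    \<open>c i + 1\<close>.\<close>
  have bdd: "bounded ((\<lambda>w. w p) ` range W)" if "p \<in> V" for p
  proof -
    obtain j i where p: "p = (j, i)" "j \<in> S" using \<open>p \<in> V\<close> by (auto simp: V_def)
    have "norm (W N p) \<le> c i + 1" for N
      using W(1)[of _ N i] W(2)[of N i] \<epsilon>(2)[of N] p \<open>finite S\<close>
        member_le_sum[of j S "\<lambda>j. W N (j, i)"] by force
    then show ?thesis by (auto intro!: boundedI)
  qed
  \<comment> \<open>Bolzano-Weierstrass for functions on the finite index set
    \<open>V\<close>.\<close>
  obtain w r where r: "strict_mono r"
    and lim: "\<And>\<delta>. \<delta> > 0 \<Longrightarrow> \<forall>\<^sub>F N in sequentially. \<forall>p\<in>V. dist (W (r N) p) (w p) < \<delta>"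
  proof -
    have "finite V" using \<open>finite S\<close> by (simp add: V_def)
    from compact_lemma_general[where f = W and proj = "\<lambda>w. w" and unproj = "\<lambda>w. w", OF this bdd refl refl]
    have "\<exists>w r. strict_mono r \<and>
        (\<forall>\<delta>>0. \<forall>\<^sub>F N in sequentially. \<forall>p\<in>V. dist (W (r N) p) (w p) < \<delta>)"
      by simp
    then show thesis using that by blast
  qed
  have tendsto: "(\<lambda>N. W (r N) (j, i)) \<longlonglongrightarrow> w (j, i)" if "j \<in> S" for j i
    by (rule tendstoI, drule lim, erule eventually_mono) (use that in \<open>auto simp: V_def\<close>)
  have "\<epsilon> \<longlonglongrightarrow> 0"
    unfolding \<epsilon>_def by (rule LIMSEQ_inverse_real_of_nat)
  then have \<epsilon>_lim: "(\<lambda>N. \<epsilon> (r N)) \<longlonglongrightarrow> 0"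
    using LIMSEQ_subseq_LIMSEQ[OF _ r] by (auto simp: o_def)
  have "0 \<le> w (j, i)" if "j \<in> S" for j i
    using LIMSEQ_le_const[OF tendsto[OF that]] W(1)[OF that] by blast
  moreover have "(\<Sum>j\<in>S. w (j, i)) \<le> c i" for i
  proof (rule LIMSEQ_le)
    show "(\<lambda>N. \<Sum>j\<in>S. W (r N) (j, i)) \<longlonglongrightarrow> (\<Sum>j\<in>S. w (j, i))"
      by (intro tendsto_sum tendsto)
    show "(\<lambda>N. c i + \<epsilon> (r N)) \<longlonglongrightarrow> c i"
      using tendsto_add[OF tendsto_const \<epsilon>_lim] by auto
  qed (use W(2) in auto)
  moreover have "b j ^ m \<le> (\<Prod>i\<in>UNIV. (real m * w (j, i) / real (e j i)) ^ e j i)" if "j \<in> S" for j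
  proof (rule LIMSEQ_le_const)
    show "(\<lambda>N. \<Prod>i\<in>UNIV. (real m * W (r N) (j, i) / real (e j i)) ^ e j i)
        \<longlonglongrightarrow> (\<Prod>i\<in>UNIV. (real m * w (j, i) / real (e j i)) ^ e j i)"
      \<comment> \<open>The divisor \<open>e j i\<close> may be 0; multiplication by its fixed
        inverse is continuous in every case.\<close>
      unfolding divide_inverse by (intro tendsto_intros tendsto that)
  qed (use W(3) that in auto)
  ultimately show ?thesis by (intro exI[of _ w]) blast
qed

section \<open>Nonnegative forms with block structure are sums of squares\<close>

text \<open>The weights split the form into one AM-GM instance for each off-diagonal term and a
  remaining diagonal with nonnegative coefficients. A positive multiple of a square monomial is a
  sum of squares by itself, hence its coefficient 0 in the hypothesis.\<close>

lemma sos_functions_diagonal_tail: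
  fixes c :: "'n::finite \<Rightarrow> real" and e :: "'j \<Rightarrow> 'n \<Rightarrow> nat"
  assumes "finite S" "0 < k" and e: "\<And>j. j \<in> S \<Longrightarrow> sum (e j) UNIV = 2 * k"
    and nonneg: "\<And>x. (\<And>i. 0 \<le> x $ i) \<Longrightarrow>
      0 \<le> (\<Sum>i\<in>UNIV. c i * (x $ i) ^ (2 * k)) -
        (\<Sum>j\<in>S. (if 0 < f j \<and> (\<forall>i. even (e j i)) then 0 else \<bar>f j\<bar>) * vpow x (e j))"
  shows "(\<lambda>x. (\<Sum>i\<in>UNIV. c i * (x $ i) ^ (2 * k)) + (\<Sum>j\<in>S. f j * vpow x (e j))) \<in> sos_functions (2 * k)"
proof -
  define b where "b j = (if 0 < f j \<and> (\<forall>i. even (e j i)) then 0 else \<bar>f j\<bar>)" for j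
  have "\<exists>w. (\<forall>j\<in>S. \<forall>i. 0 \<le> w (j, i)) \<and> (\<forall>i. (\<Sum>j\<in>S. w (j, i)) \<le> c i) \<and>
    (\<forall>j\<in>S. b j ^ (2 * k) \<le> (\<Prod>i\<in>UNIV. (real (2 * k) * w (j, i) / real (e j i)) ^ e j i))"
    by (rule exists_weights) (use assms in \<open>auto simp: b_def\<close>)
  then obtain w where w: "\<And>j i. j \<in> S \<Longrightarrow> 0 \<le> w (j, i)" "\<And>i. (\<Sum>j\<in>S. w (j, i)) \<le> c i"
    and prod: "\<And>j. j \<in> S \<Longrightarrow>
      b j ^ (2 * k) \<le> (\<Prod>i\<in>UNIV. (real (2 * k) * w (j, i) / real (e j i)) ^ e j i)"
    by blast
  have diag: "(\<lambda>x. \<Sum>i\<in>UNIV. u i * (x $ i) ^ (2 * k)) \<in> sos_functions (2 * k)"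
    if "\<And>i. 0 \<le> u i" for u :: "'n \<Rightarrow> real"
    using that by (intro sos_functions_sum sos_functions_scale sos_functions_power)
  have "(\<lambda>x. (\<Sum>i\<in>UNIV. w (j, i) * (x $ i) ^ (2 * k)) + f j * vpow x (e j)) \<in> sos_functions (2 * k)"
    if "j \<in> S" for j
  proof (cases "0 < f j \<and> (\<forall>i. even (e j i))")
    case True
    define d where "d i = e j i div 2" for i
    have ed: "e j = (\<lambda>i. 2 * d i)"
      using True by (auto simp: d_def)
    have "sum d UNIV = k"
      using e[OF that] by (simp add: ed sum_distrib_left[symmetric])
    then have "(\<lambda>x. f j * vpow x (e j)) \<in> sos_functions (2 * k)"
      using True unfolding ed vpow_double by (intro sos_functions_scale sos_functions_square) auto
    then show ?thesis
      using w(1)[OF that] by (intro sos_functions_add diag)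
  next
    case False
    then have "b j = \<bar>f j\<bar>" by (auto simp: b_def)
    then show ?thesis
      using prod[OF that] by (intro sos_functions_weighted_AMGM e that \<open>0 < k\<close> w) simp
  qed
  then have tail: "(\<lambda>x. \<Sum>j\<in>S. (\<Sum>i\<in>UNIV. w (j, i) * (x $ i) ^ (2 * k)) + f j * vpow x (e j)) \<in> sos_functions (2 * k)"
    by (rule sos_functions_sum)
  have eq: "(\<Sum>i\<in>UNIV. c i * (x $ i) ^ (2 * k)) + (\<Sum>j\<in>S. f j * vpow x (e j)) =
      1 * (\<Sum>i\<in>UNIV. (c i - (\<Sum>j\<in>S. w (j, i))) * (x $ i) ^ (2 * k)) +
      1 * (\<Sum>j\<in>S. (\<Sum>i\<in>UNIV. w (j, i) * (x $ i) ^ (2 * k)) + f j * vpow x (e j))" for x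
    using sum.swap[of "\<lambda>i j. w (j, i) * (x $ i) ^ (2 * k)" S UNIV]
    by (simp add: left_diff_distrib sum_subtractf sum.distrib sum_distrib_right)
  show ?thesis
    by (rule sos_functions_conic[OF diag tail _ _ eq]) (use w in auto)
qed

lemma vpow_eq_0:
  assumes "x $ i = 0" "a i \<noteq> 0"
  shows "vpow x a = 0"
  unfolding vpow_def using assms by (intro prod_zero) (auto intro!: bexI[of _ i])

lemma vpow_cong: "(\<And>i. a i \<noteq> 0 \<Longrightarrow> x $ i = y $ i) \<Longrightarrow> vpow x a = vpow y a"
  unfolding vpow_def by (intro prod.cong refl) (metis power_0)

text \<open>The orthant inequality of \<open>sos_functions_diagonal_tail\<close> can be checked
  block by block, because the blocks share no variables, and summed over the blocks
  afterwards.\<close>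

lemma sos_functions_block_form:
  fixes c :: "'n::finite \<Rightarrow> real" and f :: "('n \<Rightarrow>\<^sub>0 nat) \<Rightarrow> real" and L :: "'l set"
  assumes "finite L" "0 < k" and cover: "(\<Union>l\<in>L. \<Gamma> l) = UNIV"
    and disjoint: "\<And>l l'. l \<in> L \<Longrightarrow> l' \<in> L \<Longrightarrow> l \<noteq> l' \<Longrightarrow> \<Gamma> l \<inter> \<Gamma> l' = {}"
    and coeffs: "\<And>l. l \<in> L \<Longrightarrow>
      (\<exists>\<beta>\<in>Omega (2 * k) (\<Gamma> l). \<forall>\<alpha>\<in>Omega (2 * k) (\<Gamma> l) - {\<beta>}. f \<alpha> = 0) \<or>
      (\<forall>\<alpha>\<in>Omega (2 * k) (\<Gamma> l). f \<alpha> \<le> 0)"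
    and g: "\<And>x. g x = (\<Sum>i\<in>UNIV. c i * (x $ i) ^ (2 * k)) +
      (\<Sum>l\<in>L. \<Sum>\<alpha>\<in>Omega (2 * k) (\<Gamma> l). f \<alpha> * vpow x (Poly_Mapping.lookup \<alpha>))"
    and psd: "\<And>x. 0 \<le> g x"
  shows "g \<in> sos_functions (2 * k)"
proof -
  define b where "b \<alpha> = (if 0 < f \<alpha> \<and> (\<forall>i. even (Poly_Mapping.lookup \<alpha> i)) then 0 else \<bar>f \<alpha>\<bar>)" for \<alpha>
  have restrict: "0 \<le> (\<Sum>i\<in>\<Gamma> l. c i * (x $ i) ^ (2 * k)) +
      (\<Sum>\<alpha>\<in>Omega (2 * k) (\<Gamma> l). f \<alpha> * vpow x (Poly_Mapping.lookup \<alpha>))"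
    if l: "l \<in> L" for l x
  proof -
    \<comment> \<open>Variables outside the block are set to 0. Monomials of other blocks have
      positive degree, so each contains such a variable and vanishes.\<close>
    define z where "z = (\<chi> i. if i \<in> \<Gamma> l then x $ i else 0)"
    have "(\<Sum>\<alpha>\<in>Omega (2 * k) (\<Gamma> l'). f \<alpha> * vpow z (Poly_Mapping.lookup \<alpha>)) = 0"
      if "l' \<in> L - {l}" for l'
    proof (intro sum.neutral ballI)
      fix \<alpha> assume \<alpha>: "\<alpha> \<in> Omega (2 * k) (\<Gamma> l')"
      then have "(\<Sum>i\<in>UNIV. Poly_Mapping.lookup \<alpha> i) \<noteq> 0"
        using \<open>0 < k\<close> by (simp add: Omega_def mon_degree_def)
      then obtain i where i: "Poly_Mapping.lookup \<alpha> i \<noteq> 0"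
        by (meson sum.neutral)
      then have "i \<in> \<Gamma> l'"
        using \<alpha> by (auto simp: Omega_def in_keys_iff)
      then have "z $ i = 0"
        using disjoint[of l l'] that l by (auto simp: z_def)
      then show "f \<alpha> * vpow z (Poly_Mapping.lookup \<alpha>) = 0"
        using vpow_eq_0[of z i "Poly_Mapping.lookup \<alpha>"] i by simp
    qed
    then have "(\<Sum>l\<in>L. \<Sum>\<alpha>\<in>Omega (2 * k) (\<Gamma> l). f \<alpha> * vpow z (Poly_Mapping.lookup \<alpha>)) =
        (\<Sum>\<alpha>\<in>Omega (2 * k) (\<Gamma> l). f \<alpha> * vpow z (Poly_Mapping.lookup \<alpha>))"
      using l \<open>finite L\<close> by (subst sum.remove[of _ l]) auto
    also have "\<dots> = (\<Sum>\<alpha>\<in>Omega (2 * k) (\<Gamma> l). f \<alpha> * vpow x (Poly_Mapping.lookup \<alpha>))"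
    proof (intro sum.cong refl)
      fix \<alpha> assume \<alpha>: "\<alpha> \<in> Omega (2 * k) (\<Gamma> l)"
      have "vpow z (Poly_Mapping.lookup \<alpha>) = vpow x (Poly_Mapping.lookup \<alpha>)"
      proof (rule vpow_cong)
        fix i assume "Poly_Mapping.lookup \<alpha> i \<noteq> 0"
        then have "i \<in> Poly_Mapping.keys \<alpha>" by (simp add: in_keys_iff)
        then show "z $ i = x $ i" using \<alpha> by (auto simp: Omega_def z_def)
      qed
      then show "f \<alpha> * vpow z (Poly_Mapping.lookup \<alpha>) = f \<alpha> * vpow x (Poly_Mapping.lookup \<alpha>)"
        by simp
    qed
    moreover have "(\<Sum>i\<in>UNIV. c i * (z $ i) ^ (2 * k)) = (\<Sum>i\<in>\<Gamma> l. c i * (x $ i) ^ (2 * k))"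
      using \<open>0 < k\<close> by (intro sum.mono_neutral_cong_right) (auto simp: z_def)
    ultimately show ?thesis
      using psd[of z] g[of z] by simp
  qed
  have block: "0 \<le> (\<Sum>i\<in>\<Gamma> l. c i * (x $ i) ^ (2 * k)) -
      (\<Sum>\<alpha>\<in>Omega (2 * k) (\<Gamma> l). b \<alpha> * vpow x (Poly_Mapping.lookup \<alpha>))"
    if l: "l \<in> L" and x: "\<And>i. 0 \<le> x $ i" for l x
  proof -
    \<comment> \<open>A block with a positive coefficient must be of the first kind, and its
      exceptional exponent is the one with that coefficient.\<close>
    consider (nonpos) "\<forall>\<alpha>\<in>Omega (2 * k) (\<Gamma> l). f \<alpha> \<le> 0"
      | (single) \<beta> where "\<beta> \<in> Omega (2 * k) (\<Gamma> l)" "0 < f \<beta>"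
          "\<And>\<alpha>. \<alpha> \<in> Omega (2 * k) (\<Gamma> l) - {\<beta>} \<Longrightarrow> f \<alpha> = 0"
    proof (cases "\<forall>\<alpha>\<in>Omega (2 * k) (\<Gamma> l). f \<alpha> \<le> 0")
      case False
      then obtain \<gamma> where \<gamma>: "\<gamma> \<in> Omega (2 * k) (\<Gamma> l)" "0 < f \<gamma>"
        by (auto simp: not_le)
      obtain \<beta> where \<beta>: "\<And>\<alpha>. \<alpha> \<in> Omega (2 * k) (\<Gamma> l) - {\<beta>} \<Longrightarrow> f \<alpha> = 0"
        using coeffs[OF l] False by blast
      have "\<gamma> = \<beta>"
        using \<beta>[of \<gamma>] \<gamma> by (cases "\<gamma> = \<beta>") auto
      then show ?thesis using \<gamma> \<beta> single by blast
    qed (rule nonpos)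
    then show ?thesis
    proof cases
      case nonpos
      then have "(\<Sum>\<alpha>\<in>Omega (2 * k) (\<Gamma> l). b \<alpha> * vpow x (Poly_Mapping.lookup \<alpha>)) =
          - (\<Sum>\<alpha>\<in>Omega (2 * k) (\<Gamma> l). f \<alpha> * vpow x (Poly_Mapping.lookup \<alpha>))"
        unfolding sum_negf[symmetric] by (intro sum.cong refl) (force simp: b_def)
      then show ?thesis using restrict[OF l, of x] by simp
    next
      case single
      have only: "(\<Sum>\<alpha>\<in>Omega (2 * k) (\<Gamma> l). u \<alpha> * v \<alpha>) = u \<beta> * v \<beta>"
        if "\<And>\<alpha>. f \<alpha> = 0 \<Longrightarrow> u \<alpha> = 0" for u v :: "('n \<Rightarrow>\<^sub>0 nat) \<Rightarrow> real"
        using single(1,3) that by (subst sum.remove[of _ \<beta>]) (auto simp: finite_Omega)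
      have b_only: "(\<Sum>\<alpha>\<in>Omega (2 * k) (\<Gamma> l). b \<alpha> * vpow x (Poly_Mapping.lookup \<alpha>)) =
          b \<beta> * vpow x (Poly_Mapping.lookup \<beta>)"
        by (rule only) (simp add: b_def)
      show ?thesis
      proof (cases "\<forall>i. even (Poly_Mapping.lookup \<beta> i)")
        case True
        \<comment> \<open>The single term counts with coefficient 0, so only the diagonal matters.
          Its coefficients are values at unit vectors, where every off-diagonal monomial vanishes,
          having a second variable.\<close>
        have "0 \<le> c i" for i
        proof -
          obtain l' where l': "l' \<in> L" "i \<in> \<Gamma> l'" using cover by blast
          define z :: "real ^ 'n" where "z = axis i 1"
          have "vpow z (Poly_Mapping.lookup \<alpha>) = 0" if \<alpha>: "\<alpha> \<in> Omega (2 * k) (\<Gamma> l')" for \<alpha>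
          proof -
            have "\<exists>j. j \<noteq> i \<and> Poly_Mapping.lookup \<alpha> j \<noteq> 0"
            proof (rule ccontr)
              assume neg: "\<not> (\<exists>j. j \<noteq> i \<and> Poly_Mapping.lookup \<alpha> j \<noteq> 0)"
              then have "(\<Sum>j\<in>UNIV - {i}. Poly_Mapping.lookup \<alpha> j) = 0" by auto
              then have "Poly_Mapping.lookup \<alpha> i = 2 * k"
                using \<alpha> by (simp add: Omega_def mon_degree_def sum.remove[of UNIV i])
              then have "\<alpha> = Poly_Mapping.single i (2 * k)"
                using neg by (intro poly_mapping_eqI) (auto simp: lookup_single when_def)
              then show False using \<alpha> unfolding Omega_def by blast
            qed
            then obtain j where "j \<noteq> i" "Poly_Mapping.lookup \<alpha> j \<noteq> 0" by blast
            then show ?thesis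
              using vpow_eq_0[of z j "Poly_Mapping.lookup \<alpha>"] by (simp add: z_def axis_def)
          qed
          then have "0 \<le> (\<Sum>j\<in>\<Gamma> l'. c j * (z $ j) ^ (2 * k))"
            using restrict[OF l'(1), of z] by simp
          also have "\<dots> = c i"
            using l' \<open>0 < k\<close> by (subst sum.remove[of _ i]) (auto simp: z_def axis_def power_0_left)
          finally show ?thesis .
        qed
        then have "0 \<le> (\<Sum>i\<in>\<Gamma> l. c i * (x $ i) ^ (2 * k))"
          using x by (intro sum_nonneg) simp
        moreover have "b \<beta> = 0" using True single(2) by (simp add: b_def)
        ultimately show ?thesis unfolding b_only by simp
      next
        case False
        then obtain i where i: "odd (Poly_Mapping.lookup \<beta> i)" by blast
        \<comment> \<open>Reversing the sign of a coordinate with odd exponent reverses the single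
          off-diagonal term and fixes the even powers; nonnegativity at \<open>z\<close> is
          therefore the claim at \<open>x\<close>.\<close>
        define z where "z = (\<chi> j. if j = i then - (x $ i) else x $ j)"
        have "vpow z (Poly_Mapping.lookup \<beta>) = - vpow x (Poly_Mapping.lookup \<beta>)"
          using i unfolding z_def by (simp add: vpow_at vpow_remove[of x _ i])
        moreover have "(\<Sum>\<alpha>\<in>Omega (2 * k) (\<Gamma> l). f \<alpha> * vpow z (Poly_Mapping.lookup \<alpha>)) =
            f \<beta> * vpow z (Poly_Mapping.lookup \<beta>)"
          by (rule only)
        moreover have "b \<beta> = f \<beta>"
          using False single(2) by (auto simp: b_def)
        moreover have "(\<Sum>j\<in>\<Gamma> l. c j * (z $ j) ^ (2 * k)) = (\<Sum>j\<in>\<Gamma> l. c j * (x $ j) ^ (2 * k))"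
          by (intro sum.cong) (auto simp: z_def)
        ultimately show ?thesis
          using restrict[OF l, of z] unfolding b_only by simp
      qed
    qed
  qed
  \<comment> \<open>Each exponent is paired with its block, so that the double sum becomes a sum
    over one finite index set.\<close>
  define S where "S = Sigma L (\<lambda>l. Omega (2 * k) (\<Gamma> l))"
  define e where "e = (\<lambda>j :: 'l \<times> ('n \<Rightarrow>\<^sub>0 nat). Poly_Mapping.lookup (snd j))"
  have sum_S: "(\<Sum>j\<in>S. h (snd j)) = (\<Sum>l\<in>L. \<Sum>\<alpha>\<in>Omega (2 * k) (\<Gamma> l). h \<alpha>)"
    for h :: "('n \<Rightarrow>\<^sub>0 nat) \<Rightarrow> real"
    using \<open>finite L\<close> unfolding S_def by (subst sum.Sigma) (auto simp: finite_Omega case_prod_unfold)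
  have sum_\<Gamma>: "(\<Sum>i\<in>UNIV. h i) = (\<Sum>l\<in>L. \<Sum>i\<in>\<Gamma> l. h i)" for h :: "'n \<Rightarrow> real"
    unfolding cover[symmetric] using \<open>finite L\<close> disjoint by (intro sum.UNION_disjoint) auto
  have "(\<lambda>x. (\<Sum>i\<in>UNIV. c i * (x $ i) ^ (2 * k)) + (\<Sum>j\<in>S. f (snd j) * vpow x (e j))) \<in> sos_functions (2 * k)"
  proof (rule sos_functions_diagonal_tail)
    show "finite S" using \<open>finite L\<close> by (auto simp: S_def finite_Omega)
    show "sum (e j) UNIV = 2 * k" if "j \<in> S" for j
      using that by (auto simp: S_def e_def Omega_def mon_degree_def)
    show "0 \<le> (\<Sum>i\<in>UNIV. c i * (x $ i) ^ (2 * k)) -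
        (\<Sum>j\<in>S. (if 0 < f (snd j) \<and> (\<forall>i. even (e j i)) then 0 else \<bar>f (snd j)\<bar>) * vpow x (e j))"
      if "\<And>i. 0 \<le> x $ i" for x :: "real ^ 'n"
    proof -
      have "(\<Sum>j\<in>S. (if 0 < f (snd j) \<and> (\<forall>i. even (e j i)) then 0 else \<bar>f (snd j)\<bar>) * vpow x (e j)) =
          (\<Sum>l\<in>L. \<Sum>\<alpha>\<in>Omega (2 * k) (\<Gamma> l). b \<alpha> * vpow x (Poly_Mapping.lookup \<alpha>))"
        unfolding e_def b_def[symmetric] by (rule sum_S)
      then show ?thesis
        unfolding sum_\<Gamma>[of "\<lambda>i. c i * (x $ i) ^ (2 * k)"]
        using sum_nonneg[OF block[OF _ that]] by (simp only: sum_subtractf)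
    qed
  qed fact
  moreover have "(\<lambda>x. (\<Sum>i\<in>UNIV. c i * (x $ i) ^ (2 * k)) + (\<Sum>j\<in>S. f (snd j) * vpow x (e j))) = g"
  proof
    fix x
    show "(\<Sum>i\<in>UNIV. c i * (x $ i) ^ (2 * k)) + (\<Sum>j\<in>S. f (snd j) * vpow x (e j)) = g x"
      using sum_S[of "\<lambda>\<alpha>. f \<alpha> * vpow x (Poly_Mapping.lookup \<alpha>)"] by (simp add: g e_def)
  qed
  ultimately show ?thesis by simp
qed

section \<open>The minimum on the unit sphere and the greatest feasible value\<close>

lemma tensor_form_scaleR: "tensor_form m A (t *\<^sub>R x) = t ^ m * tensor_form m A x"
proof -
  have scale: "(\<Prod>i\<leftarrow>is. (t *\<^sub>R x) $ i) = t ^ length is * (\<Prod>i\<leftarrow>is. x $ i)" for "is"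
    by (induction "is") (simp_all add: mult_ac)
  then show ?thesis
    unfolding tensor_form_def sum_distrib_left
    by (intro sum.cong refl, subst scale) (auto simp: mult_ac)
qed

lemma continuous_on_tensor_form: "continuous_on S (tensor_form m A)"
proof -
  have "tensor_form m A = (\<lambda>x. \<Sum>\<alpha>\<in>Poly_Mapping.keys (tensor_poly m A).
      Poly_Mapping.lookup (tensor_poly m A) \<alpha> * vpow x (Poly_Mapping.lookup \<alpha>))"
    by (rule ext) (simp add: poly_fun_tensor_poly[symmetric] poly_fun_def vpow_def)
  then show ?thesis
    by (simp add: continuous_intros)
qed

lemma sum_power_pos:
  fixes x :: "real ^ 'n::finite"
  assumes "even m" "x \<noteq> 0"
  shows "0 < (\<Sum>i\<in>UNIV. (x $ i) ^ m)"
proof -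
  obtain i where "x $ i \<noteq> 0" using \<open>x \<noteq> 0\<close> by (auto simp: vec_eq_iff)
  then have "0 < (x $ i) ^ m" using \<open>even m\<close> by (simp add: zero_less_power_eq)
  then show ?thesis
    using \<open>even m\<close> by (intro sum_pos2[of _ i]) (auto simp: zero_le_even_power)
qed

lemma tensor_form_minimum:
  fixes A :: "'n::finite tensor"
  assumes "even m" "0 < m"
  obtains y where "(\<Sum>i\<in>UNIV. (y $ i) ^ m) = 1"
    and "\<And>x. tensor_form m A y * (\<Sum>i\<in>UNIV. (x $ i) ^ m) \<le> tensor_form m A x"
proof -
  define K where "K = {x :: real ^ 'n. (\<Sum>i\<in>UNIV. (x $ i) ^ m) = 1}"
  have "x \<in> cbox (- 1) 1" if "x \<in> K" for x
  proof -
    have "\<bar>x $ i\<bar> \<le> 1" for i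
    proof (rule ccontr)
      assume "\<not> \<bar>x $ i\<bar> \<le> 1"
      then have "1 < \<bar>x $ i\<bar> ^ m" using \<open>0 < m\<close> by (intro one_less_power) auto
      also have "\<dots> = (x $ i) ^ m" using \<open>even m\<close> by (simp add: power_even_abs)
      also have "\<dots> \<le> (\<Sum>i\<in>UNIV. (x $ i) ^ m)"
        using \<open>even m\<close> by (intro member_le_sum) (auto simp: zero_le_even_power)
      finally show False using that by (simp add: K_def)
    qed
    then show ?thesis by (simp add: mem_box_cart abs_le_iff minus_le_iff)
  qed
  then have "bounded K"
    using bounded_subset[OF bounded_cbox] by blast
  moreover have "closed K"
    unfolding K_def by (intro closed_Collect_eq continuous_intros)
  ultimately have "compact K" by (simp add: compact_eq_bounded_closed)
  have normalize: "(1 / root m (\<Sum>i\<in>UNIV. (x $ i) ^ m)) *\<^sub>R x \<in> K" if "x \<noteq> 0" for x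
    using sum_power_pos[OF \<open>even m\<close> that] \<open>0 < m\<close>
    by (simp add: K_def power_divide sum_divide_distrib[symmetric])
  have "1 \<noteq> (0 :: real ^ 'n)" by simp
  then have "K \<noteq> {}" using normalize by blast
  then obtain y where y: "y \<in> K" and min: "\<And>x. x \<in> K \<Longrightarrow> tensor_form m A y \<le> tensor_form m A x"
    using continuous_attains_inf[OF \<open>compact K\<close> _ continuous_on_tensor_form] by blast
  show thesis
  proof
    show "(\<Sum>i\<in>UNIV. (y $ i) ^ m) = 1" using y by (simp add: K_def)
    show "tensor_form m A y * (\<Sum>i\<in>UNIV. (x $ i) ^ m) \<le> tensor_form m A x" for x
    proof (cases "x = 0")
      case True
      then show ?thesis
        using tensor_form_scaleR[of m A 0 0] \<open>0 < m\<close> by (simp add: power_0_left)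
    next
      case False
      have "tensor_form m A y \<le> (1 / root m (\<Sum>i\<in>UNIV. (x $ i) ^ m)) ^ m * tensor_form m A x"
        using min[OF normalize[OF False]] by (simp only: tensor_form_scaleR)
      then show ?thesis
        using sum_power_pos[OF \<open>even m\<close> False] \<open>0 < m\<close>
        by (simp add: power_divide pos_le_divide_eq)
    qed
  qed
qed

text \<open>Subtracting \<open>r\<close> times the sum of the \<open>m\<close>-th powers alters only
  the diagonal coefficients, on which the extended Z-condition puts no sign restriction, so the
  block structure persists.\<close>

lemma extended_Z_psd_sos:
  fixes A :: "'n::finite tensor"
  assumes "even m" "0 < m" "extended_Z_tensor m A"
    and psd: "\<And>x. r * (\<Sum>i\<in>UNIV. (x $ i) ^ m) \<le> tensor_form m A x"
  shows "(\<lambda>x. tensor_form m A x - r * (\<Sum>i\<in>UNIV. (x $ i) ^ m)) \<in> sos_functions m"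
proof -
  obtain k where k: "m = 2 * k" using \<open>even m\<close> by (elim evenE)
  define f where "f = tensor_poly m A"
  obtain s :: nat and \<Gamma> where cover: "(\<Union>l\<in>{1..s}. \<Gamma> l) = (UNIV :: 'n set)"
    and disjoint: "\<forall>l\<in>{1..s}. \<forall>l'\<in>{1..s}. l \<noteq> l' \<longrightarrow> \<Gamma> l \<inter> \<Gamma> l' = {}"
    and f: "f = (\<Sum>i\<in>UNIV. Poly_Mapping.single (Poly_Mapping.single i m)
                           (Poly_Mapping.lookup f (Poly_Mapping.single i m)))
            + (\<Sum>l = 1..s. \<Sum>\<alpha>\<in>Omega m (\<Gamma> l). Poly_Mapping.single \<alpha> (Poly_Mapping.lookup f \<alpha>))"
    and coeffs: "\<forall>l\<in>{1..s}.
           (\<exists>\<beta>\<in>Omega m (\<Gamma> l). \<forall>\<alpha>\<in>Omega m (\<Gamma> l) - {\<beta>}. Poly_Mapping.lookup f \<alpha> = 0) \<or>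
           (\<forall>\<alpha>\<in>Omega m (\<Gamma> l). Poly_Mapping.lookup f \<alpha> \<le> 0)"
    using assms(3) unfolding extended_Z_tensor_def extended_Z_polynomial_def f_def[symmetric] by (elim conjE exE) blast
  have single: "vpow x (Poly_Mapping.lookup (Poly_Mapping.single i m)) = (x $ i) ^ m"
    for i and x :: "real ^ 'n"
    by (simp add: vpow_def lookup_single when_def if_distrib[of "(^) _"] cong: if_cong)
  have form: "tensor_form m A x = (\<Sum>i\<in>UNIV. Poly_Mapping.lookup f (Poly_Mapping.single i m) * (x $ i) ^ m) +
      (\<Sum>l = 1..s. \<Sum>\<alpha>\<in>Omega m (\<Gamma> l). Poly_Mapping.lookup f \<alpha> * vpow x (Poly_Mapping.lookup \<alpha>))" for x
  proof -
    have "tensor_form m A x = poly_fun f x"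
      by (simp add: f_def poly_fun_tensor_poly)
    then show ?thesis
      by (subst (asm) f) (simp only: poly_fun_add poly_fun_sum poly_fun_single_vpow single)
  qed
  show ?thesis
    unfolding k
  proof (rule sos_functions_block_form[where L = "{1..s}" and f = "Poly_Mapping.lookup f" and \<Gamma> = \<Gamma>
        and c = "\<lambda>i. Poly_Mapping.lookup f (Poly_Mapping.single i m) - r"])
    show "tensor_form (2 * k) A x - r * (\<Sum>i\<in>UNIV. (x $ i) ^ (2 * k)) =
        (\<Sum>i\<in>UNIV. (Poly_Mapping.lookup f (Poly_Mapping.single i m) - r) * (x $ i) ^ (2 * k)) +
        (\<Sum>l = 1..s. \<Sum>\<alpha>\<in>Omega (2 * k) (\<Gamma> l). Poly_Mapping.lookup f \<alpha> * vpow x (Poly_Mapping.lookup \<alpha>))" for x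
      using form[of x] by (simp add: k left_diff_distrib sum_subtractf sum_distrib_left)
    show "0 \<le> tensor_form (2 * k) A x - r * (\<Sum>i\<in>UNIV. (x $ i) ^ (2 * k))" for x
      using psd[of x] by (simp add: k)
  qed (use cover disjoint coeffs \<open>0 < m\<close> k in auto)
qed

text \<open>That the maximum is attained is part of the claim, as \<open>GREATEST\<close> denotes it
  only if it exists.\<close>

theorem corollary5p1:
  fixes m :: nat and A :: "'n::finite tensor"
  assumes "even m" and "m > 0"
    and "extended_Z_tensor m A"
  shows "(\<exists>\<mu>\<in>sos_values m A. \<forall>\<nu>\<in>sos_values m A. \<nu> \<le> \<mu>) \<and>
         (positive_definite_form m A \<longleftrightarrow> (GREATEST \<mu>. \<mu> \<in> sos_values m A) > 0)"
proof -
  obtain y where y: "(\<Sum>i\<in>UNIV. (y $ i) ^ m) = 1"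
    and min: "\<And>x. tensor_form m A y * (\<Sum>i\<in>UNIV. (x $ i) ^ m) \<le> tensor_form m A x"
    using tensor_form_minimum[OF assms(1,2), of A] by blast
  define \<rho> where "\<rho> = tensor_form m A y"
  have norm: "m_norm m x ^ m = (\<Sum>i\<in>UNIV. (x $ i) ^ m)" for x :: "real ^ 'n"
    using assms by (simp add: m_norm_power power_even_abs)
  have mem: "\<rho> \<in> sos_values m A"
    unfolding sos_values_def mem_Collect_eq
  \<comment> \<open>With \<open>r = \<rho>\<close> the two constants cancel and the form minus
    \<open>\<rho>\<close> times the sum of powers remains, which is nonnegative by
    minimality.\<close>
  proof (rule exI[of _ \<rho>])
    have "tensor_form m A x - \<rho> * (m_norm m x ^ m - 1) - \<rho> =
        tensor_form m A x - \<rho> * (\<Sum>i\<in>UNIV. (x $ i) ^ m)" for x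
      by (simp add: norm algebra_simps)
    then show "(\<lambda>x. tensor_form m A x - \<rho> * (m_norm m x ^ m - 1) - \<rho>) \<in> sos_functions m"
      using extended_Z_psd_sos[OF assms min] by (simp only: \<rho>_def)
  qed
  have le: "\<mu> \<le> \<rho>" if "\<mu> \<in> sos_values m A" for \<mu>
  proof -
    obtain r where "(\<lambda>x. tensor_form m A x - r * (m_norm m x ^ m - 1) - \<mu>) \<in> sos_functions m"
      using \<open>\<mu> \<in> sos_values m A\<close> unfolding sos_values_def by blast
    \<comment> \<open>At \<open>y\<close> the norm is 1, so the term with \<open>r\<close> vanishes
      whatever \<open>r\<close> is.\<close>
    from sos_functions_nonneg[OF this, of y] show ?thesis
      by (simp add: norm y \<rho>_def)
  qed
  have greatest: "(GREATEST \<mu>. \<mu> \<in> sos_values m A) = \<rho>"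
    using mem le by (rule Greatest_equality)
  have "positive_definite_form m A \<longleftrightarrow> 0 < \<rho>"
  proof
    assume "positive_definite_form m A"
    moreover have "y \<noteq> 0" using y \<open>m > 0\<close> by (auto simp: power_0_left)
    ultimately show "0 < \<rho>" by (simp add: positive_definite_form_def \<rho>_def)
  next
    assume "0 < \<rho>"
    show "positive_definite_form m A"
      unfolding positive_definite_form_def
    proof (intro allI impI)
      fix x :: "real ^ 'n" assume "x \<noteq> 0"
      then have "0 < \<rho> * (\<Sum>i\<in>UNIV. (x $ i) ^ m)"
        by (intro mult_pos_pos \<open>0 < \<rho>\<close> sum_power_pos assms(1))
      then show "0 < tensor_form m A x"
        using min[of x] by (simp add: \<rho>_def)
    qed
  qed
  then show ?thesis using mem le greatest by auto
qed

end
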